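(* There is an algorithm that, given any finite simple undirected connected graph $G$ with $n$ vertices and $m$ edges, computes the isometric path complexity $ipco(G)$ in $O(n^2 m)$ time.
   Context: All graphs are finite, simple, undirected and connected. A path is a sequence of distinct vertices in which consecutive vertices are adjacent. A path of $G$ is isometric if it is a shortest path in $G$ between its endpoints. Given a vertex $v$ of $G$, a set $S$ of isometric paths of $G$ is $v$-rooted if $v$ is one of the endpoints of all the isometric paths in $S$ (a single such path is called a $v$-rooted isometric path). The isometric path complexity $ipco(G)$ is the minimum integer $k$ such that there exists a vertex $v\in V(G)$ satisfying: for every isometric path $P$ of $G$, the vertices of $P$ can be covered by $k$ many $v$-rooted isometric paths of $G$ (i.e. every vertex of $P$ lies on at least one of them). *)

theory Defs
  imports
    "Graph_Theory.Pair_Digraph"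
    "Graph_Theory.Digraph_Component"
    "Graph_Theory.Vertex_Walk"
begin

section \<open>Isometric path complexity\<close>

text \<open>
  Simple undirected graphs are represented by the locale \<^locale>\<open>pair_graph\<close> (finite, symmetric,
  loop-free sets of ordered pairs) and paths by \<^const>\<open>vpath\<close>.
\<close>

definition isometric_path :: "('a, 'b) pre_digraph \<Rightarrow> 'a list \<Rightarrow> bool" where
  "isometric_path G P \<longleftrightarrow> vpath P G \<and>
     (\<forall>Q. vpath Q G \<and> hd Q = hd P \<and> last Q = last P \<longrightarrow> vwalk_length P \<le> vwalk_length Q)"

definition rooted_isometric_path :: "('a, 'b) pre_digraph \<Rightarrow> 'a \<Rightarrow> 'a list \<Rightarrow> bool" where
  "rooted_isometric_path G v P \<longleftrightarrow> isometric_path G P \<and> (v = hd P \<or> v = last P)"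

text \<open>
  Covering by \<open>k\<close> many paths allows repetitions, whence \<open>card S \<le> k\<close> for the set \<open>S\<close> of paths.
\<close>

definition ipco :: "('a, 'b) pre_digraph \<Rightarrow> nat" where
  "ipco G = (LEAST k. \<exists>v \<in> verts G. \<forall>P. isometric_path G P \<longrightarrow>
     (\<exists>S. finite S \<and> card S \<le> k \<and> (\<forall>Q \<in> S. rooted_isometric_path G v Q) \<and>
          set P \<subseteq> (\<Union>Q \<in> S. set Q)))"

text \<open>Each undirected edge is a two-element set, so that it is counted only once.\<close>

definition uedges :: "'a pair_pre_digraph \<Rightarrow> 'a set set" where
  "uedges G = (\<lambda>(u, v). {u, v}) ` parcs G"


section \<open>The machine model\<close>

text \<open>
  A word RAM, programmed by structured programs: finitely many named registers and a memory
  addressed by words, with unit cost for every arithmetic operation, comparison, memory access,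
  register access and branch. Memory addresses may be computed.
\<close>

type_synonym state = "(string \<Rightarrow> nat) \<times> (nat \<Rightarrow> nat)"

datatype aexp =
    Const nat
  | Reg string
  | Load aexp
  | Plus aexp aexp
  | Minus aexp aexp
  | Times aexp aexp

datatype bexp =
    Less aexp aexp
  | BNot bexp
  | BAnd bexp bexp

datatype com =
    Skip
  | Assign string aexp
  | Store aexp aexp
  | Seq com com
  | Cond bexp com com
  | While bexp com

text \<open>Subtraction is truncated at zero.\<close>

fun aval :: "aexp \<Rightarrow> state \<Rightarrow> nat" where
  "aval (Const k) s = k"
| "aval (Reg x) s = fst s x"
| "aval (Load a) s = snd s (aval a s)"
| "aval (Plus a b) s = aval a s + aval b s"
| "aval (Minus a b) s = aval a s - aval b s"
| "aval (Times a b) s = aval a s * aval b s"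

fun bval :: "bexp \<Rightarrow> state \<Rightarrow> bool" where
  "bval (Less a b) s \<longleftrightarrow> aval a s < aval b s"
| "bval (BNot b) s \<longleftrightarrow> \<not> bval b s"
| "bval (BAnd b c) s \<longleftrightarrow> bval b s \<and> bval c s"

text \<open>
  Words are the numbers below \<open>W\<close>. The predicates \<open>afits\<close> and \<open>bfits\<close> say that every value
  occurring in the evaluation of an expression, including every address, is a word.
\<close>

fun afits :: "nat \<Rightarrow> aexp \<Rightarrow> state \<Rightarrow> bool" where
  "afits W (Const k) s \<longleftrightarrow> k < W"
| "afits W (Reg x) s \<longleftrightarrow> fst s x < W"
| "afits W (Load a) s \<longleftrightarrow> afits W a s \<and> snd s (aval a s) < W"
| "afits W (Plus a b) s \<longleftrightarrow> afits W a s \<and> afits W b s \<and> aval a s + aval b s < W"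
| "afits W (Minus a b) s \<longleftrightarrow> afits W a s \<and> afits W b s"
| "afits W (Times a b) s \<longleftrightarrow> afits W a s \<and> afits W b s \<and> aval a s * aval b s < W"

fun bfits :: "nat \<Rightarrow> bexp \<Rightarrow> state \<Rightarrow> bool" where
  "bfits W (Less a b) s \<longleftrightarrow> afits W a s \<and> afits W b s"
| "bfits W (BNot b) s \<longleftrightarrow> bfits W b s"
| "bfits W (BAnd b c) s \<longleftrightarrow> bfits W b s \<and> bfits W c s"

fun acost :: "aexp \<Rightarrow> nat" where
  "acost (Const k) = 1"
| "acost (Reg x) = 1"
| "acost (Load a) = acost a + 1"
| "acost (Plus a b) = acost a + acost b + 1"
| "acost (Minus a b) = acost a + acost b + 1"
| "acost (Times a b) = acost a + acost b + 1"

fun bcost :: "bexp \<Rightarrow> nat" where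
  "bcost (Less a b) = acost a + acost b + 1"
| "bcost (BNot b) = bcost b + 1"
| "bcost (BAnd b c) = bcost b + bcost c + 1"

text \<open>
  \<open>exec W c s t s'\<close>: with words below \<open>W\<close>, program \<open>c\<close> started in \<open>s\<close> halts after \<open>t\<close> steps
  in \<open>s'\<close>. There is no rule for an overflow, so such a run does not halt successfully.
\<close>

inductive exec :: "nat \<Rightarrow> com \<Rightarrow> state \<Rightarrow> nat \<Rightarrow> state \<Rightarrow> bool" for W where
  Skip: "exec W Skip s 1 s"
| Assign: "afits W a s \<Longrightarrow>
    exec W (Assign x a) s (acost a + 1) ((fst s)(x := aval a s), snd s)"
| Store: "afits W a s \<Longrightarrow> afits W b s \<Longrightarrow>
    exec W (Store a b) s (acost a + acost b + 1) (fst s, (snd s)(aval a s := aval b s))"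
| Seq: "exec W c1 s t1 s1 \<Longrightarrow> exec W c2 s1 t2 s2 \<Longrightarrow> exec W (Seq c1 c2) s (t1 + t2) s2"
| CondTrue: "bfits W b s \<Longrightarrow> bval b s \<Longrightarrow> exec W c1 s t s' \<Longrightarrow>
    exec W (Cond b c1 c2) s (bcost b + 1 + t) s'"
| CondFalse: "bfits W b s \<Longrightarrow> \<not> bval b s \<Longrightarrow> exec W c2 s t s' \<Longrightarrow>
    exec W (Cond b c1 c2) s (bcost b + 1 + t) s'"
| WhileFalse: "bfits W b s \<Longrightarrow> \<not> bval b s \<Longrightarrow> exec W (While b c) s (bcost b + 1) s"
| WhileTrue: "bfits W b s \<Longrightarrow> bval b s \<Longrightarrow> exec W c s t1 s1 \<Longrightarrow> exec W (While b c) s1 t2 s2 \<Longrightarrow>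
    exec W (While b c) s (bcost b + 1 + t1 + t2) s2"

inductive_cases SkipE: "exec W Skip s t s'"
inductive_cases AssignE: "exec W (Assign x a) s t s'"
inductive_cases StoreE: "exec W (Store a b) s t s'"
inductive_cases SeqE: "exec W (Seq c1 c2) s t s'"
inductive_cases CondE: "exec W (Cond b c1 c2) s t s'"
inductive_cases WhileE: "exec W (While b c) s t s'"

lemma exec_deterministic:
  "exec W c s t s' \<Longrightarrow> exec W c s u s'' \<Longrightarrow> t = u \<and> s' = s''"
proof (induction arbitrary: u s'' rule: exec.induct)
  case (Skip s)
  then show ?case by (rule SkipE) simp
next
  case (Assign a s x)
  from Assign.prems show ?case by (rule AssignE) simp
next
  case (Store a s b)
  from Store.prems show ?case by (rule StoreE) simp
next
  case (Seq c1 s t1 s1 c2 t2 s2)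
  from Seq.prems obtain u1 r1 u2 where
    u: "u = u1 + u2" and 1: "exec W c1 s u1 r1" and 2: "exec W c2 r1 u2 s''"
    by (rule SeqE) blast
  have "t1 = u1" "s1 = r1" using Seq.IH(1)[OF 1] by auto
  with Seq.IH(2) 2 u show ?case by blast
next
  case (CondTrue b s c1 t s' c2)
  from CondTrue.prems show ?case
    by (rule CondE) (use CondTrue.hyps in \<open>auto dest: CondTrue.IH\<close>)
next
  case (CondFalse b s c2 t s' c1)
  from CondFalse.prems show ?case
    by (rule CondE) (use CondFalse.hyps in \<open>auto dest: CondFalse.IH\<close>)
next
  case (WhileFalse b s c)
  from WhileFalse.prems show ?case
    by (rule WhileE) (use WhileFalse.hyps in simp_all)
next
  case (WhileTrue b s c t1 s1 t2 s2)
  from WhileTrue.prems obtain u1 r1 u2 where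
    u: "u = bcost b + 1 + u1 + u2" and 1: "exec W c s u1 r1" and 2: "exec W (While b c) r1 u2 s''"
    by (rule WhileE) (use WhileTrue.hyps(2) in auto)
  have "t1 = u1" "s1 = r1" using WhileTrue.IH(1)[OF 1] by auto
  with WhileTrue.IH(2) 2 u show ?case by blast
qed


section \<open>Input format\<close>

text \<open>
  The input is an unsorted edge list: every undirected edge occurs exactly once, in an arbitrary
  position and orientation. The endpoints of the \<open>i\<close>-th edge are stored in the memory cells
  \<open>2 * i\<close> and \<open>2 * i + 1\<close>, and all other cells are zero.
\<close>

definition edge_list_of :: "'a pair_pre_digraph \<Rightarrow> ('a \<times> 'a) list \<Rightarrow> bool" where
  "edge_list_of G es \<longleftrightarrow>
     (let us = map (\<lambda>(u, v). {u, v}) es in distinct us \<and> set us = uedges G)"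

definition graph_input :: "nat \<Rightarrow> (nat \<times> nat) list \<Rightarrow> state" where
  "graph_input n es =
     ((\<lambda>_. 0)(''n'' := n, ''m'' := length es),
      (\<lambda>a. if a < 2 * length es
            then (if even a then fst (es ! (a div 2)) else snd (es ! (a div 2))) else 0))"

text \<open>
  \<open>computes_within P f T d\<close>: the single program \<open>P\<close> halts with \<open>f G\<close> in register \<open>out\<close> on
  every edge list of every connected simple graph \<open>G\<close> with vertices \<open>0, ..., n - 1\<close>, using words
  of \<open>d * log\<^sub>2 (n + 2)\<close> bits and at most \<open>T n m\<close> steps, where \<open>m\<close> is the number of edges.
  The time bound is omitted for the one-vertex graph, which has no edges, so that bounds such
  as \<open>n\<^sup>2 * m\<close> are meaningful; being a single graph, it does not affect \<open>O\<close>-statements.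
\<close>

definition computes_within ::
    "com \<Rightarrow> (nat pair_pre_digraph \<Rightarrow> nat) \<Rightarrow> (nat \<Rightarrow> nat \<Rightarrow> nat) \<Rightarrow> nat \<Rightarrow> bool" where
  "computes_within P f T d \<longleftrightarrow>
     (\<forall>G n m es. pair_graph G \<and> connected (with_proj G) \<and> pverts G = {0..<n} \<and>
        card (uedges G) = m \<and> edge_list_of G es \<longrightarrow>
        (\<exists>t s. exec ((n + 2) ^ d) P (graph_input n es) t s \<and> fst s ''out'' = f G \<and>
               (2 \<le> n \<longrightarrow> t \<le> T n m)))"

end

theory Submission
  imports Defs
begin

text \<open>
  Fix a root \<open>v\<close> and give every vertex its distance to \<open>v\<close> as height. Two vertices lie on a
  common \<open>v\<close>-rooted isometric path iff their heights differ by exactly their distance. On an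
  isometric path \<open>P\<close> this means that the part of \<open>P\<close> between them is strictly monotone: it
  climbs by one at every step or descends by one at every step. So the number of rooted paths
  needed for \<open>P\<close> is the least number of monotone segments into which \<open>P\<close> can be cut, and cutting
  greedily is optimal: a monotone segment extends to a rooted isometric path
  (\<open>greedy_cover\<close>), and the first vertices of the greedy segments lie pairwise on no common rooted
  isometric path, so that they need different paths (\<open>greedy_antichain\<close>).

  The greedy cut only has to remember, at the current end \<open>y\<close> of the path, the number of segments
  so far and the trend of the last one (descending, single vertex, ascending). The isometric paths
  that start in a fixed vertex \<open>s\<close> are the paths which move away from \<open>s\<close> at every step, so the
  largest number of segments for every root \<open>v\<close>, end \<open>y\<close> and trend is found by dynamic
  programming along the distance layers of \<open>s\<close>. The invariant \<open>table\<close> says that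
  all numbers in the table are attained by isometric paths and are at least the greedy numbers of
  all paths treated so far. The maximum over \<open>s\<close>, \<open>y\<close> and the trend is the number of paths that
  the root \<open>v\<close> needs, and the minimum over \<open>v\<close> is the isometric path complexity
  (\<open>ipco_eqI\<close>).

  Neither adjacency lists nor queues are needed to stay within \<open>n\<^sup>2 * m\<close> steps. The
  distances come from \<open>n\<close> rounds of relaxing all edges, for each of the \<open>n\<close> sources. For every
  source \<open>s\<close> and every layer \<open>k\<close> all edges are scanned again, which takes \<open>n\<^sup>2 * m\<close> steps in
  total; the loop over all roots \<open>v\<close> is entered only when an edge leads from layer \<open>k\<close> to layer
  \<open>k + 1\<close> of \<open>s\<close>, which happens at most once for each \<open>s\<close> and each orientation of an edge
  (\<open>sum_single_layer\<close>). Clearing the table costs \<open>n\<^sup>3\<close>, and \<open>n \<le> 2 * m\<close> for connected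
  graphs with at least two vertices (\<open>n_le\<close>).
\<close>

section \<open>Distances and isometric paths\<close>

locale connected_graph = pair_graph G for G :: "'a pair_pre_digraph" +
  assumes connected: "connected (with_proj G)"
begin

abbreviation walk :: "'a list \<Rightarrow> bool" where
  "walk p \<equiv> vwalk p (with_proj G)"

definition dist :: "'a \<Rightarrow> 'a \<Rightarrow> nat" where
  "dist u v = (LEAST k. \<exists>p. walk p \<and> hd p = u \<and> last p = v \<and> length p = Suc k)"

text \<open>
  Shortest walks are automatically free of repetitions, so isometric paths are characterised by
  their length alone (\<open>isometric_path_iff_geodesic\<close>); this is the form used throughout.
\<close>

definition geodesic :: "'a list \<Rightarrow> bool" where
  "geodesic p \<longleftrightarrow> walk p \<and> length p = Suc (dist (hd p) (last p))"

lemma verts_nonempty: "pverts G \<noteq> {}"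
  using connected by (simp add: connected_def strongly_connected_def)

lemma walk_Cons_Cons: "walk (x # y # p) \<longleftrightarrow> (x, y) \<in> parcs G \<and> walk (y # p)"
  by (auto simp: vwalk_def in_arcsD1)

lemma walk_single: "walk [x] \<longleftrightarrow> x \<in> pverts G"
  by (auto simp: vwalk_def)

lemma walk_Cons: "p \<noteq> [] \<Longrightarrow> walk (x # p) \<longleftrightarrow> (x, hd p) \<in> parcs G \<and> walk p"
  by (cases p) (auto simp: walk_Cons_Cons)

lemma walk_append: 
  "p \<noteq> [] \<Longrightarrow> q \<noteq> [] \<Longrightarrow> walk (p @ q) \<longleftrightarrow> walk p \<and> (last p, hd q) \<in> parcs G \<and> walk q"
  by (auto simp: vwalk_def vwalk_arcs_append)

lemma walk_rev: "walk (rev p) \<longleftrightarrow> walk p"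
  by (auto simp: vwalk_def set_vwalk_arcs_rev intro: arcs_symmetric)

lemma walk_nonempty: "walk p \<Longrightarrow> p \<noteq> []"
  by (auto simp: vwalk_def)

lemma walk_verts: "walk p \<Longrightarrow> z \<in> set p \<Longrightarrow> z \<in> pverts G"
  by (auto simp: vwalk_def)

lemma walk_ends: "walk p \<Longrightarrow> hd p \<in> pverts G \<and> last p \<in> pverts G"
  by (auto simp: vwalk_def)

lemma ex_walk:
  assumes "u \<in> pverts G" "v \<in> pverts G"
  shows "\<exists>p. walk p \<and> hd p = u \<and> last p = v"
proof -
  have "u \<rightarrow>\<^sup>*\<^bsub>mk_symmetric (with_proj G)\<^esub> v"
    using connected assms by (simp add: connected_def strongly_connected_def)
  then have "u \<rightarrow>\<^sup>*\<^bsub>with_proj G\<^esub> v"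
    by (simp add: reachable_mk_symmetric_eq sym_arcs)
  then show ?thesis by (simp add: reachable_vwalk_conv)
qed

lemma ex_geodesic:
  assumes "u \<in> pverts G" "v \<in> pverts G"
  obtains p where "geodesic p" "hd p = u" "last p = v"
proof -
  obtain p where p: "walk p" "hd p = u" "last p = v" using ex_walk[OF assms] by blast
  then have "length p = Suc (length p - 1)" by (auto dest: walk_nonempty)
  with p have "\<exists>k p. walk p \<and> hd p = u \<and> last p = v \<and> length p = Suc k" by blast
  then have "\<exists>p. walk p \<and> hd p = u \<and> last p = v \<and> length p = Suc (dist u v)"
    unfolding dist_def by (rule LeastI_ex)
  then show ?thesis using that by (auto simp: geodesic_def)
qed

lemma dist_less_length:
  assumes "walk p" shows "dist (hd p) (last p) < length p"
proof -
  have "length p = Suc (length p - 1)" using assms by (auto dest: walk_nonempty)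
  then have "dist (hd p) (last p) \<le> length p - 1"
    unfolding dist_def using assms by (intro Least_le) blast
  then show ?thesis using walk_nonempty[OF assms] by (cases p) auto
qed

lemma geodesic_walk: "geodesic p \<Longrightarrow> walk p" by (simp add: geodesic_def)

lemma geodesic_nonempty: "geodesic p \<Longrightarrow> p \<noteq> []"
  by (auto simp: geodesic_def)

lemma dist_self [simp]: "x \<in> pverts G \<Longrightarrow> dist x x = 0"
  using dist_less_length[of "[x]"] by (simp add: walk_single)

lemma geodesic_single: "geodesic [x] \<longleftrightarrow> x \<in> pverts G"
  by (auto simp: geodesic_def walk_single)

lemma dist_eq_0D:
  assumes "x \<in> pverts G" "y \<in> pverts G" "dist x y = 0" shows "x = y"
proof -
  obtain p where "geodesic p" "hd p = x" "last p = y" using ex_geodesic assms by blast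
  with assms(3) show ?thesis by (cases p) (auto simp: geodesic_def)
qed

lemma dist_sym_le:
  assumes "x \<in> pverts G" "y \<in> pverts G" shows "dist x y \<le> dist y x"
proof -
  obtain p where p: "geodesic p" "hd p = y" "last p = x" using ex_geodesic assms by blast
  then have "dist (hd (rev p)) (last (rev p)) < length (rev p)"
    by (intro dist_less_length) (simp add: geodesic_def walk_rev)
  with p show ?thesis by (auto simp: geodesic_def hd_rev last_rev)
qed

lemma dist_sym:
  assumes "x \<in> pverts G" "y \<in> pverts G" shows "dist x y = dist y x"
  using dist_sym_le assms by (simp add: antisym)

lemma dist_triangle:
  assumes "x \<in> pverts G" "y \<in> pverts G" "z \<in> pverts G"
  shows "dist x z \<le> dist x y + dist y z"
proof -
  obtain p where p: "geodesic p" "hd p = x" "last p = y" using ex_geodesic assms by blast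
  obtain q where q: "geodesic q" "hd q = y" "last q = z" using ex_geodesic assms by blast
  show ?thesis
  proof (cases "tl q = []")
    case True
    then show ?thesis using q geodesic_nonempty[OF q(1)] by (cases q) auto
  next
    case False
    then have "walk (p @ tl q)" "last (p @ tl q) = z" "hd (p @ tl q) = x"
      using p q by (cases q; auto simp: geodesic_def walk_append walk_Cons walk_nonempty)+
    from dist_less_length[OF this(1)] this(2,3) show ?thesis
      using p q by (auto simp: geodesic_def)
  qed
qed

lemma dist_arc_le: "(x, y) \<in> parcs G \<Longrightarrow> dist x y \<le> 1"
  using dist_less_length[of "[x, y]"] by (simp add: walk_Cons_Cons walk_single in_arcsD2)

lemma dist_arc:
  assumes "(x, y) \<in> parcs G" "v \<in> pverts G"
  shows "dist v y \<le> dist v x + 1"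
  using dist_triangle[of v x y] dist_arc_le assms
  by (meson add_left_mono in_arcsD1 in_arcsD2 le_trans)

lemma ex_previous:
  assumes "v \<in> pverts G" "x \<in> pverts G" "dist v x = Suc k"
  obtains y where "(y, x) \<in> parcs G" "dist v y = k"
proof -
  obtain p where p: "geodesic p" "hd p = x" "last p = v" using ex_geodesic assms by blast
  have len: "length p = Suc (Suc k)"
    using p assms dist_sym by (simp add: geodesic_def)
  then obtain y q where pq: "p = x # y # q" using p
    by (metis length_Suc_conv list.sel(1))
  then have xy: "(x, y) \<in> parcs G" and q: "walk (y # q)"
    using p by (auto simp: geodesic_def walk_Cons_Cons)
  have V: "y \<in> pverts G" using xy in_arcsD2 by blast
  have "dist y v < length (y # q)" using dist_less_length[OF q] p pq by simp
  then have "dist v y \<le> k" using len pq V assms dist_sym by simp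
  moreover have "Suc k \<le> dist v y + 1"
    using dist_arc[of y x v] xy assms arcs_symmetric by auto
  ultimately show ?thesis using that xy arcs_symmetric by (metis le_antisym Suc_eq_plus1 Suc_le_mono)
qed

lemma geodesic_ConsI:
  assumes "geodesic p" "(x, hd p) \<in> parcs G" "dist x (last p) = Suc (dist (hd p) (last p))"
  shows "geodesic (x # p)"
  using assms geodesic_nonempty[OF assms(1)] by (simp add: geodesic_def walk_Cons)

lemma geodesic_ConsD:
  assumes "geodesic (x # y # p)"
  shows "geodesic (y # p)" "(x, y) \<in> parcs G"
    "dist x (last (y # p)) = Suc (dist y (last (y # p)))"
proof -
  have w: "walk (y # p)" and xy: "(x, y) \<in> parcs G"
    and len: "dist x (last (y # p)) = Suc (length p)"
    using assms by (auto simp: geodesic_def walk_Cons_Cons)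
  have V: "x \<in> pverts G" "y \<in> pverts G" "last (y # p) \<in> pverts G"
    using xy walk_ends[OF w] by (auto simp: in_arcsD1)
  have "dist y (last (y # p)) \<le> length p" using dist_less_length[OF w] by simp
  moreover have "dist x (last (y # p)) \<le> 1 + dist y (last (y # p))"
    using dist_triangle[OF V] dist_arc_le[OF xy] by linarith
  ultimately show "geodesic (y # p)" "(x, y) \<in> parcs G"
    "dist x (last (y # p)) = Suc (dist y (last (y # p)))"
    using w xy len by (auto simp: geodesic_def)
qed

text \<open>
  By induction along the walk the triangle inequality leaves no slack: a detour over \<open>z\<close> that was
  longer than the distance of the ends would already be longer for the tail.
\<close>

lemma geodesic_between:
  assumes "geodesic p" "z \<in> set p"
  shows "dist (hd p) z + dist z (last p) = dist (hd p) (last p)"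
  using assms
proof (induction p)
  case Nil then show ?case by simp
next
  case (Cons x p)
  have V: "x \<in> pverts G" "z \<in> pverts G"
    using Cons.prems by (auto simp: geodesic_def intro: walk_verts)
  show ?case
  proof (cases "z = x")
    case True
    then show ?thesis using V by simp
  next
    case False
    then obtain y q where p: "p = y # q" "z \<in> set p" using Cons.prems by (cases p) auto
    note g = geodesic_ConsD[OF Cons.prems(1)[unfolded p(1)]]
    have V': "y \<in> pverts G" "last p \<in> pverts G"
      using g(1) p by (auto simp: geodesic_def dest: walk_ends)
    have "dist y z + dist z (last p) = dist y (last p)"
      using Cons.IH g(1) p by simp
    moreover have "dist x z \<le> 1 + dist y z"
      using dist_triangle[of x y z] V V' dist_arc_le[OF g(2)] by linarith
    moreover have "dist x (last p) \<le> dist x z + dist z (last p)"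
      using dist_triangle V V' by blast
    ultimately show ?thesis using g(3) p by simp
  qed
qed

lemma geodesic_dist_Cons:
  assumes "geodesic (x # y # p)" "z \<in> set (y # p)"
  shows "dist x z = Suc (dist y z)"
proof -
  note g = geodesic_ConsD[OF assms(1)]
  have "dist x z + dist z (last (y # p)) = dist x (last (y # p))"
    using geodesic_between[OF assms(1), of z] assms(2) by auto
  moreover have "dist y z + dist z (last (y # p)) = dist y (last (y # p))"
    using geodesic_between[OF g(1) assms(2)] by auto
  ultimately show ?thesis using g(3) by linarith
qed

lemma geodesic_distinct: "geodesic p \<Longrightarrow> distinct p"
proof (induction p rule: induct_list012)
  case (3 x y p)
  have "x \<notin> set (y # p)"
    using geodesic_dist_Cons[OF 3(3), of x] 3(3) dist_self
    by (metis geodesic_walk list.set_intros(1) nat.distinct(1) walk_verts)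
  then show ?case using 3(2) geodesic_ConsD(1)[OF 3(3)] by simp
qed auto

lemma isometric_path_iff_geodesic: "isometric_path (with_proj G) p \<longleftrightarrow> geodesic p"
proof
  assume p: "isometric_path (with_proj G) p"
  then have w: "walk p" by (auto simp: isometric_path_def vpath_def)
  then obtain q where q: "geodesic q" "hd q = hd p" "last q = last p"
    using ex_geodesic walk_ends by metis
  then have "vpath q (with_proj G)" by (simp add: vpath_def geodesic_distinct geodesic_walk)
  then have "length p - 1 \<le> length q - 1" using p q by (auto simp: isometric_path_def)
  then show "geodesic p"
    using w q dist_less_length[OF w] by (auto simp: geodesic_def)
next
  assume p: "geodesic p"
  have "length p - 1 \<le> length q - 1" if "vpath q (with_proj G)" "hd q = hd p" "last q = last p" for q
    using dist_less_length[of q] that p by (auto simp: geodesic_def vpath_def)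
  then show "isometric_path (with_proj G) p"
    using p by (simp add: isometric_path_def vpath_def geodesic_distinct geodesic_walk)
qed

lemma dist_less_card:
  assumes "x \<in> pverts G" "y \<in> pverts G" shows "dist x y < card (pverts G)"
proof -
  obtain p where p: "geodesic p" "hd p = x" "last p = y" using ex_geodesic assms by blast
  have "length p = card (set p)" using p geodesic_distinct distinct_card by metis
  also have "\<dots> \<le> card (pverts G)"
    using p by (intro card_mono) (auto simp: finite_verts intro: walk_verts geodesic_walk)
  finally show ?thesis using p by (simp add: geodesic_def)
qed

lemma geodesic_rev: "geodesic (rev p) \<longleftrightarrow> geodesic p"
proof (cases "p = []")
  case False
  then show ?thesis
    using dist_sym walk_ends by (auto simp: geodesic_def walk_rev hd_rev last_rev)
qed simp


section \<open>Covering an isometric path greedily\<close>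

text \<open>
  The heights of \<open>a\<close> and \<open>b\<close> above \<open>v\<close> differ as much as they possibly can.
\<close>

definition aligned :: "'a \<Rightarrow> 'a \<Rightarrow> 'a \<Rightarrow> bool" where
  "aligned v a b \<longleftrightarrow> dist v a = dist v b + dist a b \<or> dist v b = dist v a + dist a b"

text \<open>
  Seen from its first vertex, the distances along a shortest walk just count the steps.
\<close>

lemma aligned_on_geodesic:
  assumes "geodesic q" "a \<in> set q" "b \<in> set q"
  shows "aligned (hd q) a b"
  using assms
proof (induction q arbitrary: a b)
  case Nil then show ?case by simp
next
  case (Cons x q)
  have V: "x \<in> pverts G" "a \<in> pverts G" "b \<in> pverts G"
    using Cons.prems by (auto simp: geodesic_def intro: walk_verts)
  show ?case
  proof (cases "a = x \<or> b = x")
    case True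
    then show ?thesis using V dist_sym by (auto simp: aligned_def)
  next
    case False
    then obtain y r where q: "q = y # r" "a \<in> set q" "b \<in> set q"
      using Cons.prems by (cases q) auto
    have "aligned y a b"
      using Cons.IH q geodesic_ConsD(1) Cons.prems(1) by fastforce
    then show ?thesis
      using geodesic_dist_Cons[of x y r] Cons.prems(1) q by (auto simp: aligned_def)
  qed
qed

lemma aligned_on_rooted:
  assumes "rooted_isometric_path (with_proj G) v q" "a \<in> set q" "b \<in> set q"
  shows "aligned v a b"
proof -
  have q: "geodesic q" "v = hd q \<or> v = last q"
    using assms by (auto simp: rooted_isometric_path_def isometric_path_iff_geodesic)
  then show ?thesis
    using aligned_on_geodesic[of q a b] aligned_on_geodesic[of "rev q" a b] assms
    by (auto simp: geodesic_rev hd_rev)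
qed

end

text \<open>
  A trend is encoded as the last height difference plus one, so that it is a natural number: \<open>0\<close>
  for a descending segment, \<open>2\<close> for an ascending one, and \<open>1\<close> for a segment that consists of a
  single vertex. The step \<open>e\<close> is encoded in the same way; a step \<open>e = 1\<close> on one level never stays
  inside a segment.
\<close>

fun continues :: "nat \<Rightarrow> nat \<Rightarrow> bool" where
  "continues t e \<longleftrightarrow> e \<noteq> 1 \<and> (t = 1 \<or> t = e)"

fun advance :: "nat \<Rightarrow> nat \<times> nat \<Rightarrow> nat \<times> nat" where
  "advance e (t, c) = (if continues t e then (e, c) else (1, c + 1))"

text \<open>
  Trend of the last segment and number of segments of the greedy cut. The current end of the path is
  the head of the list, so that extending a path is a \<open>Cons\<close>.
\<close>

fun greedy :: "('a \<Rightarrow> nat) \<Rightarrow> 'a list \<Rightarrow> nat \<times> nat" where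
  "greedy h (y # x # p) =
     advance (h y + 1 - h x) (greedy h (x # p))"
| "greedy h p = (1, length p)"

context connected_graph
begin

lemma aligned_sym: 
  "a \<in> pverts G \<Longrightarrow> b \<in> pverts G \<Longrightarrow> aligned v a b \<longleftrightarrow> aligned v b a"
  using dist_sym by (auto simp: aligned_def)

text \<open>
  The set \<open>A\<close> consists of the first vertices of the segments, and \<open>b\<close> is the first vertex of the last
  segment. A new segment starts at \<open>y\<close> exactly if the path from \<open>b\<close> to \<open>y\<close> is not monotone, that is,
  the height difference of \<open>b\<close> and \<open>y\<close> is smaller than their distance. This defect cannot be made up
  on the remaining way from \<open>b\<close> to an earlier vertex of \<open>A\<close>, since a height changes by at most the
  distance; hence \<open>y\<close> is aligned with no vertex of \<open>A\<close>.
\<close>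

lemma greedy_antichain:
  assumes "geodesic p" "v \<in> pverts G" "greedy (dist v) p = (t, c)"
  shows "\<exists>A b. A \<subseteq> set p \<and> card A = c \<and> (\<forall>a\<in>A. \<forall>a'\<in>A. a \<noteq> a' \<longrightarrow> \<not> aligned v a a') \<and>
    b \<in> A \<and> (\<forall>a\<in>A. dist (hd p) a = dist (hd p) b + dist b a) \<and>
    (t = 1 \<and> hd p = b \<or>
     t = 2 \<and> hd p \<noteq> b \<and> dist v (hd p) = dist v b + dist (hd p) b \<or>
     t = 0 \<and> hd p \<noteq> b \<and> dist v b = dist v (hd p) + dist (hd p) b)"
  using assms(1,3)
proof (induction p arbitrary: t c rule: induct_list012)
  case 1 then show ?case by (simp add: geodesic_def)
next
  case (2 x)
  then show ?case by (intro exI[of _ "{x}"] exI[of _ x]) (auto simp: geodesic_single)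
next
  case (3 y x p)
  note g = geodesic_ConsD[OF 3(3)]
  obtain t' c' where r: "greedy (dist v) (x # p) = (t', c')" by fastforce
  obtain A b where A: "A \<subseteq> set (x # p)" "card A = c'"
      "\<forall>a\<in>A. \<forall>a'\<in>A. a \<noteq> a' \<longrightarrow> \<not> aligned v a a'" and b: "b \<in> A"
      "\<forall>a\<in>A. dist x a = dist x b + dist b a"
      "t' = 1 \<and> x = b \<or>
       t' = 2 \<and> x \<noteq> b \<and> dist v x = dist v b + dist x b \<or>
       t' = 0 \<and> x \<noteq> b \<and> dist v b = dist v x + dist x b"
    using 3(2)[OF g(1) r] unfolding list.sel by blast
  have V: "y \<in> pverts G" "x \<in> pverts G" "\<And>a. a \<in> A \<Longrightarrow> a \<in> pverts G"
    using g(1,2) A(1) walk_verts[OF geodesic_walk[OF g(1)]]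
    by (auto simp: in_arcsD1 in_arcsD2)
  have step: "dist y a = Suc (dist x a)" if "a \<in> set (x # p)" for a
    using geodesic_dist_Cons[OF 3(3) that] .
  have bA: "b \<in> set (x # p)" using A(1) b(1) by blast
  have far: "\<forall>a\<in>A. dist y a = dist y b + dist b a"
    using b(2) step A(1) bA by (metis add_Suc subsetD)
  have yA: "y \<notin> A" using step[of y] A(1) dist_self[OF V(1)] by (metis nat.distinct(1) subsetD)
  have fin: "finite A" using A(1) finite_subset by blast
  have hxy: "dist v y \<le> dist v x + 1" "dist v x \<le> dist v y + 1"
    using dist_arc g(2) arcs_symmetric assms(2) by blast+
  have sb: "dist y b = Suc (dist x b)" by (rule step[OF bA])
  have xb: "x = b \<Longrightarrow> dist x b = 0" using V(2) by simp
  have mono: "t' = 1 \<or> t' = 2 \<Longrightarrow> dist v x = dist v b + dist x b"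
    "t' = 1 \<or> t' = 0 \<Longrightarrow> dist v b = dist v x + dist x b"
    using b(3) xb by (elim disjE conjE; simp)+
  let ?e = "dist v y + 1 - dist v x"
  show ?case
  proof (cases "continues t' ?e")
    case True
    then have t: "t = ?e" "c = c'" using 3(4) r by (simp_all del: continues.simps)
    have yb: "y \<noteq> b" using yA b(1) by blast
    have trend: "t = 2 \<and> dist v y = dist v b + dist y b \<or> t = 0 \<and> dist v b = dist v y + dist y b"
    proof -
      consider (up) "?e = 2" "t' = 1 \<or> t' = 2" | (down) "?e = 0" "t' = 1 \<or> t' = 0"
        using True hxy by fastforce
      then show ?thesis
      proof cases
        case up
        then show ?thesis using mono(1) sb t(1) by linarith
      next
        case down
        then show ?thesis using mono(2) sb hxy t(1) by linarith
      qed
    qed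
    show ?thesis
    proof (intro exI[of _ A] exI[of _ b] conjI)
      show "t = 1 \<and> hd (y # x # p) = b \<or>
       t = 2 \<and> hd (y # x # p) \<noteq> b \<and> dist v (hd (y # x # p)) = dist v b + dist (hd (y # x # p)) b \<or>
       t = 0 \<and> hd (y # x # p) \<noteq> b \<and> dist v b = dist v (hd (y # x # p)) + dist (hd (y # x # p)) b"
        unfolding list.sel using trend yb by blast
      show "A \<subseteq> set (y # x # p)" using A(1) by auto
      show "card A = c" using A(2) t(2) by (rule trans[OF _ sym])
      show "\<forall>a\<in>A. dist (hd (y # x # p)) a = dist (hd (y # x # p)) b + dist b a"
        unfolding list.sel by (rule far)
    qed (rule A(3) b(1))+
  next
    case False
    then have t: "t = 1" "c = c' + 1" using 3(4) r by (simp_all del: continues.simps)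
    \<comment> \<open>a step against the trend, or on one level, makes the way from \<open>b\<close> to \<open>y\<close> non-monotone\<close>
    have bb: "dist v y < dist v b + dist y b \<and> dist v b < dist v y + dist y b"
    proof (cases "x = b")
      case True
      then have "t' = 1" using b(3) by blast
      then have "dist v y = dist v x" using False hxy by fastforce
      then show ?thesis using True sb by simp
    next
      case neq: False
      have pos: "dist x b > 0" using dist_eq_0D[OF V(2) V(3)[OF b(1)]] neq by blast
      have "t' = 2 \<or> t' = 0" using b(3) neq by blast
      then show ?thesis
      proof
        assume "t' = 2"
        then have "dist v y \<le> dist v x" using False hxy by fastforce
        then show ?thesis using mono(1) \<open>t' = 2\<close> pos sb hxy by linarith
      next
        assume "t' = 0"
        then have "dist v x \<le> dist v y" using False hxy by fastforce
        then show ?thesis using mono(2) \<open>t' = 0\<close> pos sb hxy by linarith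
      qed
    qed
    have new: "\<not> aligned v y a" if "a \<in> A" for a
    proof -
      have "dist v b \<le> dist v a + dist b a" "dist v a \<le> dist v b + dist b a"
        using dist_triangle[of v a b] dist_triangle[of v b a] dist_sym[of a b] V that b(1) assms(2)
        by metis+
      moreover have "dist y a = dist y b + dist b a" using far that by blast
      ultimately show ?thesis using bb unfolding aligned_def by linarith
    qed
    have new': "\<not> aligned v a y" if "a \<in> A" for a
      using new[OF that] aligned_sym[OF V(1) V(3)[OF that]] by simp
    show ?thesis
    proof (intro exI[of _ "insert y A"] exI[of _ y] conjI)
      show "\<forall>a\<in>insert y A. \<forall>a'\<in>insert y A. a \<noteq> a' \<longrightarrow> \<not> aligned v a a'"
        using new new' A(3) by blast
    qed (use A(1,2) t yA fin V(1) in auto)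
  qed
qed

lemma cover_lower_bound:
  assumes "geodesic p" "v \<in> pverts G" "finite S" "set p \<subseteq> (\<Union>q\<in>S. set q)"
    "\<forall>q\<in>S. rooted_isometric_path (with_proj G) v q"
  shows "snd (greedy (dist v) p) \<le> card S"
proof -
  obtain A where A: "A \<subseteq> set p" "card A = snd (greedy (dist v) p)"
    "\<forall>a\<in>A. \<forall>a'\<in>A. a \<noteq> a' \<longrightarrow> \<not> aligned v a a'"
    using greedy_antichain[OF assms(1,2)] by (metis prod.collapse)
  have "\<forall>a\<in>A. \<exists>q\<in>S. a \<in> set q" using A(1) assms(4) by blast
  then obtain f where f: "\<And>a. a \<in> A \<Longrightarrow> f a \<in> S \<and> a \<in> set (f a)" by metis
  \<comment> \<open>a rooted path cannot contain two vertices of the antichain\<close>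
  have "inj_on f A"
  proof (rule inj_onI, rule ccontr)
    fix a a' assume "a \<in> A" "a' \<in> A" "f a = f a'" "a \<noteq> a'"
    then show False using A(3) f aligned_on_rooted assms(5) by metis
  qed
  then show ?thesis using card_inj_on_le[of f A S] f assms(3) A(2) by auto
qed

text \<open>
  All segments but the last are covered by fewer than \<open>c\<close> rooted paths, and the last one is kept
  in a form that can still grow. An ascending segment is the beginning of a shortest walk \<open>q\<close> from
  the current end to \<open>v\<close>, which grows at its head. For a descending segment the list \<open>l\<close> leads
  from the start of the segment to just before the current end and can be completed to a shortest
  walk by every shortest walk \<open>q\<close> from the current end to \<open>v\<close>. A segment with a single vertex
  can develop in both ways.
\<close>

lemma greedy_cover:
  assumes "geodesic p" "v \<in> pverts G" "greedy (dist v) p = (t, c)"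
  shows "\<exists>S. finite S \<and> card S < c \<and> (\<forall>q\<in>S. rooted_isometric_path (with_proj G) v q) \<and>
    (t = 1 \<and> set p \<subseteq> insert (hd p) (\<Union>q\<in>S. set q) \<or>
     t = 2 \<and> (\<exists>q. geodesic q \<and> hd q = hd p \<and> last q = v \<and> set p \<subseteq> set q \<union> (\<Union>q\<in>S. set q)) \<or>
     t = 0 \<and> (\<exists>l. set p \<subseteq> insert (hd p) (set l) \<union> (\<Union>q\<in>S. set q) \<and>
        (\<forall>q. geodesic q \<and> hd q = hd p \<and> last q = v \<longrightarrow> geodesic (l @ q))))"
  using assms(1,3)
proof (induction p arbitrary: t c rule: induct_list012)
  case 1 then show ?case by (simp add: geodesic_def)
next
  case (2 x)
  then show ?case by (intro exI[of _ "{}"]) auto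
next
  case (3 y x p)
  note g = geodesic_ConsD[OF 3(3)]
  obtain t' c' where r: "greedy (dist v) (x # p) = (t', c')" by fastforce
  obtain S where S: "finite S" "card S < c'" "\<forall>q\<in>S. rooted_isometric_path (with_proj G) v q"
    and c: "t' = 1 \<and> set (x # p) \<subseteq> insert x (\<Union>q\<in>S. set q) \<or>
     t' = 2 \<and> (\<exists>q. geodesic q \<and> hd q = x \<and> last q = v \<and> set (x # p) \<subseteq> set q \<union> (\<Union>q\<in>S. set q)) \<or>
     t' = 0 \<and> (\<exists>l. set (x # p) \<subseteq> insert x (set l) \<union> (\<Union>q\<in>S. set q) \<and>
        (\<forall>q. geodesic q \<and> hd q = x \<and> last q = v \<longrightarrow> geodesic (l @ q)))"
    using 3(2)[OF g(1) r] unfolding list.sel by blast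
  have V: "y \<in> pverts G" "x \<in> pverts G" using g(2) by (auto simp: in_arcsD1 in_arcsD2)
  have hxy: "dist v y \<le> dist v x + 1" "dist v x \<le> dist v y + 1"
    using dist_arc g(2) arcs_symmetric assms(2) by blast+
  have yx: "(y, x) \<in> parcs G" "(x, y) \<in> parcs G" using g(2) arcs_symmetric by auto
  obtain q0 where q0: "geodesic q0" "hd q0 = x" "last q0 = v"
    using ex_geodesic V assms(2) by blast
  let ?e = "dist v y + 1 - dist v x"
  show ?case
  proof (cases "continues t' ?e")
    case True
    then have t: "t = ?e" "c = c'" using 3(4) r by (simp_all del: continues.simps)
    consider (up) "?e = 2" "t' = 1 \<or> t' = 2" | (down) "?e = 0" "t' = 1 \<or> t' = 0"
      using True hxy by fastforce
    then show ?thesis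
    proof cases
      case up
      have "\<exists>q. geodesic q \<and> hd q = x \<and> last q = v \<and> set (x # p) \<subseteq> set q \<union> (\<Union>q\<in>S. set q)"
        using up(2)
      proof
        assume "t' = 1"
        then show ?thesis using c q0 hd_in_set[OF geodesic_nonempty[OF q0(1)]]
          by (intro exI[of _ q0]) auto
      qed (use c in auto)
      then obtain q where q: "geodesic q" "hd q = x" "last q = v"
        "set (x # p) \<subseteq> set q \<union> (\<Union>q\<in>S. set q)" by blast
      have "geodesic (y # q)"
        using q yx up V assms(2) dist_sym by (intro geodesic_ConsI) auto
      then have "\<exists>q. geodesic q \<and> hd q = y \<and> last q = v \<and> set (y # x # p) \<subseteq> set q \<union> (\<Union>q\<in>S. set q)"
        using q geodesic_nonempty by (intro exI[of _ "y # q"]) auto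
      then show ?thesis using S t up by (intro exI[of _ S]) auto
    next
      case down
      have "\<exists>l. set (x # p) \<subseteq> insert x (set l) \<union> (\<Union>q\<in>S. set q) \<and>
        (\<forall>q. geodesic q \<and> hd q = x \<and> last q = v \<longrightarrow> geodesic (l @ q))"
        using down(2) c by (elim disjE) (auto intro: exI[of _ "[]"])
      then obtain l where l: "set (x # p) \<subseteq> insert x (set l) \<union> (\<Union>q\<in>S. set q)"
        "\<And>q. geodesic q \<Longrightarrow> hd q = x \<Longrightarrow> last q = v \<Longrightarrow> geodesic (l @ q)" by blast
      have "geodesic ((l @ [x]) @ q)" if q: "geodesic q" "hd q = y" "last q = v" for q
      proof -
        have "geodesic (x # q)"
          using q yx down V assms(2) dist_sym hxy by (intro geodesic_ConsI) auto
        then show ?thesis using l(2)[of "x # q"] q geodesic_nonempty by simp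
      qed
      then have "\<exists>l. set (y # x # p) \<subseteq> insert y (set l) \<union> (\<Union>q\<in>S. set q) \<and>
        (\<forall>q. geodesic q \<and> hd q = y \<and> last q = v \<longrightarrow> geodesic (l @ q))"
        using l(1) by (intro exI[of _ "l @ [x]"]) auto
      then show ?thesis using S t down by (intro exI[of _ S]) auto
    qed
  next
    case False
    then have t: "t = 1" "c = c' + 1" using 3(4) r by (simp_all del: continues.simps)
    have "\<exists>q. rooted_isometric_path (with_proj G) v q \<and> set (x # p) \<subseteq> set q \<union> (\<Union>q\<in>S. set q)"
      using c
    proof (elim disjE conjE exE)
      assume "set (x # p) \<subseteq> insert x (\<Union>q\<in>S. set q)"
      then show ?thesis using q0 geodesic_nonempty[OF q0(1)]
        by (intro exI[of _ q0])
          (auto simp: rooted_isometric_path_def isometric_path_iff_geodesic)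
    next
      fix q assume "geodesic q" "last q = v" "set (x # p) \<subseteq> set q \<union> (\<Union>q\<in>S. set q)"
      then show ?thesis
        by (intro exI[of _ q]) (auto simp: rooted_isometric_path_def isometric_path_iff_geodesic)
    next
      fix l assume "set (x # p) \<subseteq> insert x (set l) \<union> (\<Union>q\<in>S. set q)"
        "\<forall>q. geodesic q \<and> hd q = x \<and> last q = v \<longrightarrow> geodesic (l @ q)"
      then show ?thesis using q0 geodesic_nonempty[OF q0(1)]
        by (intro exI[of _ "l @ q0"])
          (auto simp: rooted_isometric_path_def isometric_path_iff_geodesic)
    qed
    then obtain q where q: "rooted_isometric_path (with_proj G) v q"
      "set (x # p) \<subseteq> set q \<union> (\<Union>q\<in>S. set q)" by blast
    show ?thesis
      using S t q by (intro exI[of _ "insert q S"]) (auto simp: card_insert_if)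
  qed
qed

lemma cover_iff_runs_of:
  assumes "geodesic p" "v \<in> pverts G"
  shows "(\<exists>S. finite S \<and> card S \<le> k \<and> (\<forall>q\<in>S. rooted_isometric_path (with_proj G) v q) \<and>
    set p \<subseteq> (\<Union>q\<in>S. set q)) \<longleftrightarrow> snd (greedy (dist v) p) \<le> k" (is "?L \<longleftrightarrow> ?R")
proof
  assume ?L
  then show ?R using cover_lower_bound[OF assms] by (meson le_trans)
next
  assume R: ?R
  obtain t c where r: "greedy (dist v) p = (t, c)" by fastforce
  obtain S where S: "finite S" "card S < c" "\<forall>q\<in>S. rooted_isometric_path (with_proj G) v q"
   and c: "t = 1 \<and> set p \<subseteq> insert (hd p) (\<Union>q\<in>S. set q) \<or>
     t = 2 \<and> (\<exists>q. geodesic q \<and> hd q = hd p \<and> last q = v \<and> set p \<subseteq> set q \<union> (\<Union>q\<in>S. set q)) \<or>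
     t = 0 \<and> (\<exists>l. set p \<subseteq> insert (hd p) (set l) \<union> (\<Union>q\<in>S. set q) \<and>
        (\<forall>q. geodesic q \<and> hd q = hd p \<and> last q = v \<longrightarrow> geodesic (l @ q)))"
    using greedy_cover[OF assms r] by blast
  obtain q0 where q0: "geodesic q0" "hd q0 = hd p" "last q0 = v"
    using ex_geodesic walk_ends geodesic_walk assms by metis
  have "\<exists>q. rooted_isometric_path (with_proj G) v q \<and> set p \<subseteq> set q \<union> (\<Union>q\<in>S. set q)"
    using c
  proof (elim disjE conjE exE)
    assume "set p \<subseteq> insert (hd p) (\<Union>q\<in>S. set q)"
    then show ?thesis using q0 geodesic_nonempty[OF q0(1)] hd_in_set[of q0]
      by (intro exI[of _ q0])
        (auto simp: rooted_isometric_path_def isometric_path_iff_geodesic)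
  next
    fix q assume "geodesic q" "last q = v" "set p \<subseteq> set q \<union> (\<Union>q\<in>S. set q)"
    then show ?thesis
      by (intro exI[of _ q]) (auto simp: rooted_isometric_path_def isometric_path_iff_geodesic)
  next
    fix l assume "set p \<subseteq> insert (hd p) (set l) \<union> (\<Union>q\<in>S. set q)"
      "\<forall>q. geodesic q \<and> hd q = hd p \<and> last q = v \<longrightarrow> geodesic (l @ q)"
    then show ?thesis using q0 geodesic_nonempty[OF q0(1)] hd_in_set[of q0]
      by (intro exI[of _ "l @ q0"])
        (auto simp: rooted_isometric_path_def isometric_path_iff_geodesic)
  qed
  then obtain q where q: "rooted_isometric_path (with_proj G) v q"
    "set p \<subseteq> set q \<union> (\<Union>q\<in>S. set q)" by blast
  then show ?L
    using S R r by (intro exI[of _ "insert q S"]) (auto simp: card_insert_if)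
qed

lemma greedy_Cons:
  "p \<noteq> [] \<Longrightarrow> greedy h (y # p) = advance (h y + 1 - h (hd p)) (greedy h p)"
  by (cases p) auto

lemma greedy_bounds:
  assumes "geodesic p" "v \<in> pverts G"
  shows "fst (greedy (dist v) p) < 3" "1 \<le> snd (greedy (dist v) p)"
    "snd (greedy (dist v) p) \<le> length p"
proof -
  have "fst (greedy (dist v) p) < 3 \<and> 1 \<le> snd (greedy (dist v) p) \<and>
    snd (greedy (dist v) p) \<le> length p"
    using assms(1)
  proof (induction p rule: induct_list012)
    case 1 then show ?case by (simp add: geodesic_def)
  next
    case (2 x) then show ?case by simp
  next
    case (3 y x p)
    note g = geodesic_ConsD[OF 3(3)]
    have "dist v y \<le> dist v x + 1" using dist_arc[of x y v] g(2) arcs_symmetric assms(2) by blast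
    moreover obtain t c where "greedy (dist v) (x # p) = (t, c)" by fastforce
    ultimately show ?case using 3(2)[OF g(1)] by auto
  qed
  then show "fst (greedy (dist v) p) < 3" "1 \<le> snd (greedy (dist v) p)"
    "snd (greedy (dist v) p) \<le> length p" by auto
qed

lemma geodesic_length_le: "geodesic p \<Longrightarrow> length p \<le> card (pverts G)"
  using dist_less_card walk_ends by (fastforce simp: geodesic_def)

lemma ipco_eqI:
  assumes "w \<in> pverts G" "\<And>p. geodesic p \<Longrightarrow> snd (greedy (dist w) p) \<le> k"
    and "\<And>v. v \<in> pverts G \<Longrightarrow> \<exists>p. geodesic p \<and> k \<le> snd (greedy (dist v) p)"
  shows "ipco (with_proj G) = k"
proof -
  have "ipco (with_proj G) =
    (LEAST k. \<exists>v\<in>pverts G. \<forall>p. geodesic p \<longrightarrow> snd (greedy (dist v) p) \<le> k)"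
    unfolding ipco_def isometric_path_iff_geodesic
    by (intro arg_cong[of _ _ Least] ext) (auto simp: cover_iff_runs_of)
  also have "\<dots> = k"
  proof (rule Least_equality)
    show "\<exists>v\<in>pverts G. \<forall>p. geodesic p \<longrightarrow> snd (greedy (dist v) p) \<le> k"
      using assms(1,2) by blast
  next
    fix l assume "\<exists>v\<in>pverts G. \<forall>p. geodesic p \<longrightarrow> snd (greedy (dist v) p) \<le> l"
    then show "k \<le> l" using assms(3) le_trans by blast
  qed
  finally show ?thesis .
qed

end

section \<open>Verifying programs with costs\<close>

text \<open>
  Total correctness with a bound on the number of steps. Since \<open>exec\<close> has no rule for an overflow,
  it includes that every value fits into a word.
\<close>

definition runs :: "nat \<Rightarrow> com \<Rightarrow> state \<Rightarrow> nat \<Rightarrow> (state \<Rightarrow> bool) \<Rightarrow> bool" where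
  "runs W c s T Q \<longleftrightarrow> (\<exists>t s'. exec W c s t s' \<and> t \<le> T \<and> Q s')"

fun assigned :: "com \<Rightarrow> string set" where
  "assigned Skip = {}"
| "assigned (Assign x a) = {x}"
| "assigned (Store a b) = {}"
| "assigned (Seq c1 c2) = assigned c1 \<union> assigned c2"
| "assigned (Cond b c1 c2) = assigned c1 \<union> assigned c2"
| "assigned (While b c) = assigned c"

lemma exec_unassigned: "exec W c s t s' \<Longrightarrow> r \<notin> assigned c \<Longrightarrow> fst s' r = fst s r"
  by (induction rule: exec.induct) auto

lemma runs_frame:
  "runs W c s T Q \<Longrightarrow> runs W c s T (\<lambda>s'. Q s' \<and> (\<forall>r. r \<notin> assigned c \<longrightarrow> fst s' r = fst s r))"
  unfolding runs_def using exec_unassigned by blast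

lemma runs_mono:
  "runs W c s T Q \<Longrightarrow> T \<le> T' \<Longrightarrow> (\<And>s'. Q s' \<Longrightarrow> Q' s') \<Longrightarrow> runs W c s T' Q'"
  unfolding runs_def by (meson le_trans)

lemma runs_Seq:
  assumes "runs W c1 s T1 Q1" "\<And>s'. Q1 s' \<Longrightarrow> runs W c2 s' T2 Q" "T1 + T2 \<le> T"
  shows "runs W (Seq c1 c2) s T Q"
proof -
  obtain t1 s1 where 1: "exec W c1 s t1 s1" "t1 \<le> T1" "Q1 s1"
    using assms(1) unfolding runs_def by blast
  obtain t2 s2 where 2: "exec W c2 s1 t2 s2" "t2 \<le> T2" "Q s2"
    using assms(2)[OF 1(3)] unfolding runs_def by blast
  then show ?thesis unfolding runs_def
    using exec.Seq[OF 1(1) 2(1)] 1 assms(3) by (meson add_mono le_trans)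
qed

lemma runs_Cond:
  assumes "bfits W b s" "bval b s \<Longrightarrow> runs W c1 s T1 Q" "\<not> bval b s \<Longrightarrow> runs W c2 s T2 Q"
    "bcost b + 1 + (if bval b s then T1 else T2) \<le> T"
  shows "runs W (Cond b c1 c2) s T Q"
proof (cases "bval b s")
  case True
  then obtain t s' where t: "exec W c1 s t s'" "t \<le> T1" "Q s'"
    using assms(2) unfolding runs_def by blast
  with True assms(1,4) show ?thesis
    unfolding runs_def using exec.CondTrue[OF assms(1) True t(1)] by fastforce
next
  case False
  then obtain t s' where t: "exec W c2 s t s'" "t \<le> T2" "Q s'"
    using assms(3) unfolding runs_def by blast
  with False assms(1,4) show ?thesis
    unfolding runs_def using exec.CondFalse[OF assms(1) False t(1)] by fastforce
qed

text \<open>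
  Weakest preconditions and worst-case costs of programs without loops, which reduce their
  verification to simplification. A loop has precondition \<open>False\<close>; loops are treated by
  \<open>runs_For\<close>.
\<close>

fun wp :: "nat \<Rightarrow> com \<Rightarrow> state \<Rightarrow> (state \<Rightarrow> bool) \<Rightarrow> bool" where
  "wp W Skip s Q \<longleftrightarrow> Q s"
| "wp W (Assign x a) s Q \<longleftrightarrow> afits W a s \<and> Q ((fst s)(x := aval a s), snd s)"
| "wp W (Store a b) s Q \<longleftrightarrow>
    afits W a s \<and> afits W b s \<and> Q (fst s, (snd s)(aval a s := aval b s))"
| "wp W (Seq c1 c2) s Q \<longleftrightarrow> wp W c1 s (\<lambda>s'. wp W c2 s' Q)"
| "wp W (Cond b c1 c2) s Q \<longleftrightarrow>
    bfits W b s \<and> (if bval b s then wp W c1 s Q else wp W c2 s Q)"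
| "wp W (While b c) s Q \<longleftrightarrow> False"

fun maxcost :: "com \<Rightarrow> nat" where
  "maxcost Skip = 1"
| "maxcost (Assign x a) = acost a + 1"
| "maxcost (Store a b) = acost a + acost b + 1"
| "maxcost (Seq c1 c2) = maxcost c1 + maxcost c2"
| "maxcost (Cond b c1 c2) = bcost b + 1 + max (maxcost c1) (maxcost c2)"
| "maxcost (While b c) = 0"

lemma runs_wp: "wp W c s Q \<Longrightarrow> maxcost c \<le> T \<Longrightarrow> runs W c s T Q"
proof (induction c arbitrary: s Q T)
  case (Seq c1 c2)
  show ?case
  proof (rule runs_Seq)
    show "runs W c1 s (maxcost c1) (\<lambda>s'. wp W c2 s' Q)" using Seq by simp
    show "\<And>s'. wp W c2 s' Q \<Longrightarrow> runs W c2 s' (maxcost c2) Q" using Seq.IH(2) by simp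
    show "maxcost c1 + maxcost c2 \<le> T" using Seq.prems by simp
  qed
next
  case (Cond b c1 c2)
  show ?case
  proof (rule runs_Cond)
    show "bfits W b s" using Cond.prems by simp
    show "bval b s \<Longrightarrow> runs W c1 s (maxcost c1) Q" using Cond by simp
    show "\<not> bval b s \<Longrightarrow> runs W c2 s (maxcost c2) Q" using Cond by simp
    show "bcost b + 1 + (if bval b s then maxcost c1 else maxcost c2) \<le> T"
      using Cond.prems by auto
  qed
next
  case Skip
  then show ?case unfolding runs_def using exec.Skip by fastforce
next
  case (Assign x a)
  then show ?case unfolding runs_def using exec.Assign[of W a s x] by fastforce
next
  case (Store a b)
  then show ?case unfolding runs_def using exec.Store[of W a s b] by fastforce
qed simp

definition For :: "string \<Rightarrow> aexp \<Rightarrow> com \<Rightarrow> com" where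
  "For i b c = Seq (Assign i (Const 0))
     (While (Less (Reg i) b) (Seq c (Assign i (Plus (Reg i) (Const 1)))))"

lemma assigned_For [simp]: "assigned (For i b c) = insert i (assigned c)"
  by (auto simp: For_def)

text \<open>
  The invariant speaks of the memory only: everything known about the registers follows from the
  loop counter and from the registers that the body does not assign. The time bound \<open>T k\<close> may
  depend on the round, which is needed for the amortised cost of scanning the edges layer by layer.
\<close>

lemma runs_For:
  assumes i: "i \<notin> assigned c"
    and b: "\<And>R M. (\<forall>r. r \<notin> insert i (assigned c) \<longrightarrow> R r = R0 r) \<Longrightarrow>
      aval b (R, M) = N \<and> afits W b (R, M)"
    and W: "N < W" "1 < W"
    and init: "I 0 M0"
    and step: "\<And>k R M. k < N \<Longrightarrow> R i = k \<Longrightarrow>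
      (\<forall>r. r \<notin> insert i (assigned c) \<longrightarrow> R r = R0 r) \<Longrightarrow> I k M \<Longrightarrow>
      runs W c (R, M) (T k) (\<lambda>s'. I (Suc k) (snd s'))"
    and post: "\<And>R M. (\<forall>r. r \<notin> insert i (assigned c) \<longrightarrow> R r = R0 r) \<Longrightarrow> I N M \<Longrightarrow> Q (R, M)"
    and time: "(\<Sum>k<N. T k) + N * (acost b + 7) + (acost b + 5) \<le> T'"
  shows "runs W (For i b c) (R0, M0) T' Q"
proof -
  let ?frame = "\<lambda>R. \<forall>r. r \<notin> insert i (assigned c) \<longrightarrow> R r = R0 r"
  let ?w = "While (Less (Reg i) b) (Seq c (Assign i (Plus (Reg i) (Const 1))))"
  have loop: "runs W ?w (R, M) ((\<Sum>j=k..<N. T j) + (N - k) * (acost b + 7) + (acost b + 3)) Q"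
    if "k \<le> N" "R i = k" "?frame R" "I k M" for k R M
    using that
  proof (induction "N - k" arbitrary: k R M)
    case 0
    then have "k = N" by simp
    then have "exec W ?w (R, M) (bcost (Less (Reg i) b) + 1) (R, M)"
      using 0 b[of R M] W by (intro exec.WhileFalse) auto
    then show ?case unfolding runs_def using 0 \<open>k = N\<close> post[of R M]
      by (intro exI[of _ "acost b + 3"] exI[of _ "(R, M)"]) (simp add: eval_nat_numeral)
  next
    case (Suc l)
    then have k: "k < N" by simp
    obtain t1 R1 M1 where 1: "exec W c (R, M) t1 (R1, M1)" "t1 \<le> T k" "I (Suc k) M1"
      using step[OF k Suc.prems(2-4)] unfolding runs_def by auto
    have R1: "R1 r = R r" if "r \<notin> assigned c" for r
      using exec_unassigned[OF 1(1) that] by simp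
    have 2: "exec W (Seq c (Assign i (Plus (Reg i) (Const 1)))) (R, M) (t1 + 4)
        (R1(i := Suc k), M1)"
      using exec.Seq[OF 1(1) exec.Assign[of W "Plus (Reg i) (Const 1)" "(R1, M1)" i]]
        R1[OF i] Suc.prems(2) k W by (simp add: eval_nat_numeral)
    have "runs W ?w (R1(i := Suc k), M1)
      ((\<Sum>j=Suc k..<N. T j) + (N - Suc k) * (acost b + 7) + (acost b + 3)) Q"
      using Suc.hyps k 1(3) Suc.prems(3) R1 by (intro Suc.hyps(1)) auto
    then obtain t2 s2 where 3: "exec W ?w (R1(i := Suc k), M1) t2 s2"
      "t2 \<le> (\<Sum>j=Suc k..<N. T j) + (N - Suc k) * (acost b + 7) + (acost b + 3)" "Q s2"
      unfolding runs_def by blast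
    have "exec W ?w (R, M) (bcost (Less (Reg i) b) + 1 + (t1 + 4) + t2) s2"
      using b[OF Suc.prems(3)] W k Suc.prems(2) by (intro exec.WhileTrue[OF _ _ 2 3(1)]) auto
    moreover have "bcost (Less (Reg i) b) + 1 + (t1 + 4) + t2 \<le>
        (\<Sum>j=k..<N. T j) + (N - k) * (acost b + 7) + (acost b + 3)"
    proof -
      have "N - k = Suc (N - Suc k)" using k by simp
      then have "(N - k) * (acost b + 7) = (N - Suc k) * (acost b + 7) + (acost b + 7)"
        by simp
      moreover have "(\<Sum>j=k..<N. T j) = T k + (\<Sum>j=Suc k..<N. T j)"
        using k by (rule sum.atLeast_Suc_lessThan)
      ultimately show ?thesis using 1(2) 3(2) by simp
    qed
    ultimately show ?case unfolding runs_def using 3(3) by blast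
  qed
  have w: "runs W ?w (R0(i := 0), M0) ((\<Sum>j=0..<N. T j) + (N - 0) * (acost b + 7) + (acost b + 3)) Q"
    using init by (intro loop) auto
  have a: "runs W (Assign i (Const 0)) (R0, M0) 2 (\<lambda>s'. s' = (R0(i := 0), M0))"
    using W by (intro runs_wp) auto
  show ?thesis
    unfolding For_def
  proof (rule runs_Seq[OF a])
    show "runs W ?w s' ((\<Sum>j=0..<N. T j) + (N - 0) * (acost b + 7) + (acost b + 3)) Q"
      if "s' = (R0(i := 0), M0)" for s'
      using w that by simp
  qed (use time in \<open>simp add: atLeast0LessThan\<close>)
qed

lemma runs_For_const:
  assumes i: "i \<notin> assigned c"
    and b: "\<And>R M. (\<forall>r. r \<notin> insert i (assigned c) \<longrightarrow> R r = R0 r) \<Longrightarrow>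
      aval b (R, M) = N \<and> afits W b (R, M)"
    and W: "N < W" "1 < W"
    and init: "I 0 M0"
    and step: "\<And>k R M. k < N \<Longrightarrow> R i = k \<Longrightarrow>
      (\<forall>r. r \<notin> insert i (assigned c) \<longrightarrow> R r = R0 r) \<Longrightarrow> I k M \<Longrightarrow>
      runs W c (R, M) T (\<lambda>s'. I (Suc k) (snd s'))"
    and post: "\<And>R M. (\<forall>r. r \<notin> insert i (assigned c) \<longrightarrow> R r = R0 r) \<Longrightarrow> I N M \<Longrightarrow> Q (R, M)"
    and time: "N * (T + acost b + 7) + (acost b + 5) \<le> T'"
  shows "runs W (For i b c) (R0, M0) T' Q"
proof (rule runs_For[where I = I and N = N and T = "\<lambda>_. T", OF i])
  show "(\<Sum>k<N. T) + N * (acost b + 7) + (acost b + 5) \<le> T'"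
    using time by (simp add: algebra_simps)
qed (fact b W init step post)+

section \<open>The program\<close>

text \<open>
  Above the edge list, the memory contains the distance matrix with entries \<open>(u, x)\<close>, the table of
  the dynamic program with entries \<open>(v, y, d)\<close> for a root \<open>v\<close>, an end \<open>y\<close> of paths and a trend \<open>d\<close>,
  and one number for every root, followed by a cell for their minimum.
\<close>

definition dist_exp :: "string \<Rightarrow> string \<Rightarrow> aexp" where
  "dist_exp u x = Plus (Times (Const 2) (Reg ''m'')) (Plus (Times (Reg u) (Reg ''n'')) (Reg x))"

definition table_base_exp :: aexp where
  "table_base_exp = Plus (Times (Const 2) (Reg ''m'')) (Times (Reg ''n'') (Reg ''n''))"

definition table_exp :: "string \<Rightarrow> string \<Rightarrow> aexp \<Rightarrow> aexp" where
  "table_exp v y d = Plus table_base_exp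
     (Plus (Times (Const 3) (Plus (Times (Reg v) (Reg ''n'')) (Reg y))) d)"

definition best_exp :: "string \<Rightarrow> aexp" where
  "best_exp v = Plus (Plus (Times (Const 2) (Reg ''m''))
     (Times (Const 4) (Times (Reg ''n'') (Reg ''n'')))) (Reg v)"

definition Eq :: "aexp \<Rightarrow> aexp \<Rightarrow> bexp" where
  "Eq a b = BAnd (BNot (Less a b)) (BNot (Less b a))"

definition raise :: "aexp \<Rightarrow> aexp \<Rightarrow> com" where
  "raise a b = Cond (Less (Load a) b) (Store a b) Skip"

definition lower :: "aexp \<Rightarrow> aexp \<Rightarrow> com" where
  "lower a b = Cond (Less b (Load a)) (Store a b) Skip"

text \<open>
  The two orientations of the edge number \<open>e\<close> are obtained for \<open>(i, j) = (0, 1)\<close> and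
  \<open>(i, j) = (1, 0)\<close>.
\<close>

definition load_arc :: "nat \<Rightarrow> nat \<Rightarrow> com" where
  "load_arc i j = Seq
     (Assign ''x'' (Load (Plus (Times (Const 2) (Reg ''e'')) (Const i))))
     (Assign ''y'' (Load (Plus (Times (Const 2) (Reg ''e'')) (Const j))))"

definition ForArcs :: "com \<Rightarrow> com" where
  "ForArcs c = For ''e'' (Reg ''m'') (Seq (Seq (load_arc 0 1) c) (Seq (load_arc 1 0) c))"

text \<open>
  For every source \<open>u\<close> all edges are relaxed \<open>n\<close> times. The entry \<open>n\<close> stands for infinity, since all
  distances are smaller.
\<close>

definition distances :: com where
  "distances = For ''u'' (Reg ''n'')
     (Seq (For ''x'' (Reg ''n'') (Store (dist_exp ''u'' ''x'') (Reg ''n'')))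
     (Seq (Store (dist_exp ''u'' ''u'') (Const 0))
       (For ''k'' (Reg ''n'')
         (ForArcs (lower (dist_exp ''u'' ''y'') (Plus (Load (dist_exp ''u'' ''x'')) (Const 1)))))))"

text \<open>
  Extends the paths that end in \<open>x\<close> with trend \<open>d\<close> by the vertex \<open>y\<close>, for the root \<open>v\<close>. The register
  \<open>f\<close> is the new trend and \<open>c\<close> the new number of segments; an entry \<open>0\<close> of the table says that there
  is no such path.
\<close>

definition extend :: com where
  "extend = Seq (Assign ''c'' (Load (table_exp ''v'' ''x'' (Reg ''d''))))
     (Cond (Less (Const 0) (Reg ''c''))
       (Seq (Assign ''f'' (Minus (Plus (Load (dist_exp ''v'' ''y'')) (Const 1)) (Load (dist_exp ''v'' ''x''))))
       (Seq (Cond (BAnd (BNot (Eq (Reg ''f'') (Const 1)))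
                    (BNot (BAnd (BNot (Eq (Reg ''d'') (Const 1))) (BNot (Eq (Reg ''d'') (Reg ''f''))))))
              Skip
              (Seq (Assign ''f'' (Const 1)) (Assign ''c'' (Plus (Reg ''c'') (Const 1)))))
       (Seq (raise (table_exp ''v'' ''y'' (Reg ''f'')) (Reg ''c''))
            (raise (best_exp ''v'') (Reg ''c'')))))
       Skip)"

definition extend_all :: com where
  "extend_all = Cond (BAnd (Eq (Load (dist_exp ''s'' ''x'')) (Reg ''k''))
                      (Eq (Load (dist_exp ''s'' ''y'')) (Plus (Reg ''k'') (Const 1))))
     (For ''v'' (Reg ''n'') (For ''d'' (Const 3) extend)) Skip"

text \<open>
  The only path from \<open>s\<close> that is present initially consists of \<open>s\<close> alone; it is a segment with a single
  vertex, of trend \<open>1\<close>.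
\<close>

definition clear :: com where
  "clear = Seq
     (For ''q'' (Times (Const 3) (Times (Reg ''n'') (Reg ''n'')))
        (Store (Plus table_base_exp (Reg ''q'')) (Const 0)))
     (For ''v'' (Reg ''n'') (Store (table_exp ''v'' ''s'' (Const 1)) (Const 1)))"

definition cover_numbers :: com where
  "cover_numbers = Seq (For ''v'' (Reg ''n'') (Store (best_exp ''v'') (Const 1)))
     (For ''s'' (Reg ''n'') (Seq clear (For ''k'' (Reg ''n'') (ForArcs extend_all))))"

definition minimum :: com where
  "minimum = Seq (Store (best_exp ''n'') (Reg ''n''))
     (Seq (For ''v'' (Reg ''n'') (lower (best_exp ''n'') (Load (best_exp ''v''))))
          (Assign ''out'' (Load (best_exp ''n''))))"

definition ipco_program :: com where
  "ipco_program = Seq distances (Seq cover_numbers minimum)"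

lemma assigned_simps [simp]:
  "assigned (ForArcs c) = {''e'', ''x'', ''y''} \<union> assigned c"
  "assigned (raise a b) = {}"
  "assigned (lower a b) = {}"
  "assigned extend = {''c'', ''f''}"
  "assigned extend_all = {''v'', ''d'', ''c'', ''f''}"
  "assigned clear = {''q'', ''v''}"
  by (auto simp: ForArcs_def load_arc_def raise_def lower_def extend_def extend_all_def clear_def)

lemma cost_simps [simp]:
  "acost (dist_exp u x) = 9" "acost table_base_exp = 7" "acost (table_exp v y d) = acost d + 16" "acost (best_exp v) = 11"
  "bcost (Eq a b) = 2 * acost a + 2 * acost b + 5"
  by (auto simp: dist_exp_def table_base_exp_def table_exp_def best_exp_def Eq_def)

lemma bval_Eq [simp]: "bval (Eq a b) s \<longleftrightarrow> aval a s = aval b s"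
  "bfits W (Eq a b) s \<longleftrightarrow> afits W a s \<and> afits W b s"
  by (auto simp: Eq_def)



section \<open>Input, word size and memory layout\<close>

locale edge_list_input = connected_graph G for G :: "nat pair_pre_digraph" +
  fixes n m :: nat and es :: "(nat \<times> nat) list"
  assumes verts: "pverts G = {0..<n}" and card_edges: "card (uedges G) = m"
    and edge_list: "edge_list_of G es"
begin

definition W :: nat where "W = (n + 2) ^ 12"

lemma in_verts [simp]: "x \<in> pverts G \<longleftrightarrow> x < n"
  by (simp add: verts)

lemma n_pos: "0 < n"
  using verts_nonempty verts by simp

lemma length_es: "length es = m"
  using edge_list card_edges distinct_card by (fastforce simp: edge_list_of_def Let_def)

lemma uedges_es: "uedges G = (\<lambda>e. {fst (es ! e), snd (es ! e)}) ` {..<m}"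
proof -
  have "uedges G = (\<lambda>a. {fst a, snd a}) ` set es"
    using edge_list by (simp add: edge_list_of_def Let_def case_prod_beta)
  also have "set es = (!) es ` {..<m}"
    using length_es by (auto simp: set_conv_nth)
  finally show ?thesis by (simp add: image_image)
qed

lemma arcs_es:
  assumes "e < m"
  shows "(fst (es ! e), snd (es ! e)) \<in> parcs G" "(snd (es ! e), fst (es ! e)) \<in> parcs G"
proof -
  have "{fst (es ! e), snd (es ! e)} \<in> uedges G"
    unfolding uedges_es using assms by blast
  then have "(fst (es ! e), snd (es ! e)) \<in> parcs G \<or> (snd (es ! e), fst (es ! e)) \<in> parcs G"
    by (auto simp: uedges_def doubleton_eq_iff)
  then show "(fst (es ! e), snd (es ! e)) \<in> parcs G" "(snd (es ! e), fst (es ! e)) \<in> parcs G"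
    using arcs_symmetric by blast+
qed

lemma parcs_es: "parcs G = (\<Union>e<m. {(fst (es ! e), snd (es ! e)), (snd (es ! e), fst (es ! e))})"
proof
  show "parcs G \<subseteq> (\<Union>e<m. {(fst (es ! e), snd (es ! e)), (snd (es ! e), fst (es ! e))})"
  proof
    fix a assume a: "a \<in> parcs G"
    then have "{fst a, snd a} \<in> uedges G" by (auto simp: uedges_def case_prod_beta)
    then obtain e where "e < m" "{fst a, snd a} = {fst (es ! e), snd (es ! e)}"
      unfolding uedges_es by blast
    then show "a \<in> (\<Union>e<m. {(fst (es ! e), snd (es ! e)), (snd (es ! e), fst (es ! e))})"
      by (cases a) (auto simp: doubleton_eq_iff)
  qed
qed (use arcs_es in auto)

lemma arc_less: "(x, y) \<in> parcs G \<Longrightarrow> x < n \<and> y < n"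
  using in_arcsD1 in_arcsD2 in_verts by blast

lemma m_le: "m \<le> n * n"
proof -
  have "m \<le> card (parcs G)"
    unfolding card_edges[symmetric] uedges_def by (intro card_image_le) (simp add: finite_arcs)
  also have "\<dots> \<le> card ({0..<n} \<times> {0..<n})"
    using arc_less by (intro card_mono) auto
  finally show ?thesis by simp
qed

text \<open>
  By connectedness every vertex lies on an edge.
\<close>

lemma n_le:
  assumes "2 \<le> n" shows "n \<le> 2 * m"
proof -
  have fin: "finite (uedges G)" by (simp add: uedges_def finite_arcs)
  have "\<exists>w. (w, x) \<in> parcs G" if x: "x < n" for x
  proof -
    obtain z where z: "z < n" "z \<noteq> x"
      using assms by (cases "x = 0") (auto intro: that[of 1] that[of 0])
    then have "dist z x \<noteq> 0" using dist_eq_0D x by force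
    then obtain k where "dist z x = Suc k" using not0_implies_Suc by blast
    then show ?thesis using ex_previous[of z x] x z by (metis in_verts)
  qed
  then have "{0..<n} \<subseteq> \<Union>(uedges G)" by (force simp: uedges_def)
  then have "card {0..<n} \<le> card (\<Union>(uedges G))"
    using fin by (intro card_mono) (auto simp: uedges_def)
  also have "\<dots> \<le> (\<Sum>A\<in>uedges G. card A)" by (rule card_Union_le_sum_card)
  also have "\<dots> \<le> (\<Sum>A\<in>uedges G. 2)"
    by (intro sum_mono) (auto simp: uedges_def card_insert_if)
  finally show ?thesis using card_edges by simp
qed

text \<open>
  The exponent \<open>12\<close> makes words larger than all addresses, which are below a small multiple of
  \<open>(n + 2)\<^sup>2\<close>; all other values are at most of this order.
\<close>

lemma W_large: "1024 * (n * n) + 1024 * n + 1024 \<le> W"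
proof -
  have "(2::nat) ^ 10 \<le> (n + 2) ^ 10" by (intro power_mono) auto
  then have "(n + 2) ^ 2 * 2 ^ 10 \<le> (n + 2) ^ 2 * (n + 2) ^ 10" by (rule mult_le_mono2)
  also have "\<dots> = W" unfolding W_def power_add[symmetric] by simp
  finally show ?thesis by (simp add: power2_eq_square algebra_simps)
qed

definition dist_cell :: "nat \<Rightarrow> nat \<Rightarrow> nat" where
  "dist_cell u x = 2 * m + (u * n + x)"

definition table_cell :: "nat \<Rightarrow> nat \<Rightarrow> nat \<Rightarrow> nat" where
  "table_cell v y d = 2 * m + n * n + (3 * (v * n + y) + d)"

definition best_cell :: "nat \<Rightarrow> nat" where
  "best_cell v = 2 * m + 4 * (n * n) + v"

lemma index_less: "u < n \<Longrightarrow> x < n \<Longrightarrow> u * n + x < n * n"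
proof -
  assume "u < n" "x < n"
  then have "u * n + x < Suc u * n" by simp
  also have "\<dots> \<le> n * n" using \<open>u < n\<close> by (intro mult_right_mono) auto
  finally show ?thesis .
qed

lemma index_eq_iff: "x < n \<Longrightarrow> x' < n \<Longrightarrow> u * n + x = u' * n + x' \<longleftrightarrow> u = u' \<and> x = x'"
proof
  assume x: "x < n" "x' < n" and eq: "u * n + x = u' * n + x'"
  have "(u * n + x) div n = (u' * n + x') div n" using eq by simp
  then have "u = u'" using x by simp
  then show "u = u' \<and> x = x'" using eq by simp
qed simp

lemma dist_cell_eq_iff: "x < n \<Longrightarrow> x' < n \<Longrightarrow> dist_cell u x = dist_cell u' x' \<longleftrightarrow> u = u' \<and> x = x'"
  by (simp add: dist_cell_def index_eq_iff)

lemma table_cell_eq_iff: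
  assumes "y < n" "y' < n" "d < 3" "d' < 3"
  shows "table_cell v y d = table_cell v' y' d' \<longleftrightarrow> v = v' \<and> y = y' \<and> d = d'"
proof -
  have "3 * i + d = 3 * j + d' \<longleftrightarrow> i = j \<and> d = d'" for i j using assms(3,4) by presburger
  then show ?thesis using index_eq_iff[OF assms(1,2)] unfolding table_cell_def by (metis add_left_cancel)
qed

lemma best_cell_eq_iff: "best_cell v = best_cell v' \<longleftrightarrow> v = v'"
  by (simp add: best_cell_def)

lemma dist_cell_bounds: "2 * m \<le> dist_cell u x" "u < n \<Longrightarrow> x < n \<Longrightarrow> dist_cell u x < 2 * m + n * n"
  using index_less by (auto simp: dist_cell_def)

lemma table_cell_bounds: "2 * m + n * n \<le> table_cell v y d"
  "v < n \<Longrightarrow> y < n \<Longrightarrow> d < 3 \<Longrightarrow> table_cell v y d < 2 * m + 4 * (n * n)"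
  using index_less[of v y] by (auto simp: table_cell_def)

lemma best_cell_bounds: "2 * m + 4 * (n * n) \<le> best_cell v"
  by (simp add: best_cell_def)

lemma table_cell_neq_best_cell: "v < n \<Longrightarrow> y < n \<Longrightarrow> d < 3 \<Longrightarrow> table_cell v y d \<noteq> best_cell v'"
  using table_cell_bounds(2)[of v y d] best_cell_bounds[of v'] by simp

abbreviation sized :: "(string \<Rightarrow> nat) \<Rightarrow> bool" where
  "sized R \<equiv> R ''n'' = n \<and> R ''m'' = m"

lemma W_simps: "k \<le> n \<Longrightarrow> k < W" "k \<le> 1024 \<Longrightarrow> k < W"
   "n * n < W" "3 * (n * n) < W"  "3 < W" "2 < W" "1 < W" "0 < W" "Suc 0 < W" "2 * m < W" "m < W" "n < W"
  using W_large m_le n_pos by linarith+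

lemma dist_cell_eval:
  assumes "sized R" "R u < n" "R x < n"
  shows "aval (dist_exp u x) (R, M) = dist_cell (R u) (R x)" "afits W (dist_exp u x) (R, M)"
  using assms W_large m_le index_less[of "R u" "R x"]
  by (simp_all add: dist_exp_def dist_cell_def)

lemma table_base_eval:
  assumes "sized R"
  shows "aval table_base_exp (R, M) = 2 * m + n * n" "afits W table_base_exp (R, M)"
  using assms W_large m_le by (simp_all add: table_base_exp_def)

lemma table_cell_eval:
  assumes "sized R" "R v < n" "R y < n" "aval d (R, M) < 3"
  shows "aval (table_exp v y d) (R, M) = table_cell (R v) (R y) (aval d (R, M))"
    "afits W (table_exp v y d) (R, M) \<longleftrightarrow> afits W d (R, M)"
  using assms W_large m_le index_less[of "R v" "R y"] table_base_eval[OF assms(1)]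
  by (simp_all add: table_exp_def table_cell_def)

lemma best_cell_eval:
  assumes "sized R" "R v \<le> n"
  shows "aval (best_exp v) (R, M) = best_cell (R v)" "afits W (best_exp v) (R, M)"
  using assms W_large m_le by (simp_all add: best_exp_def best_cell_def)

definition holds_edges :: "(nat \<Rightarrow> nat) \<Rightarrow> bool" where
  "holds_edges M \<longleftrightarrow> (\<forall>e<m. M (2 * e) = fst (es ! e) \<and> M (2 * e + 1) = snd (es ! e))"

lemma holds_edges_upd: "2 * m \<le> a \<Longrightarrow> holds_edges (M(a := z)) \<longleftrightarrow> holds_edges M"
  by (auto simp: holds_edges_def)

text \<open>
  The order of the edge list is arbitrary, hence the invariant depends only on the set of arcs
  that have been treated. The body may rely on the edge list because every instance of the invariant
  contains it.
\<close>

lemma runs_ForArcs: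
  assumes c: "assigned c \<inter> {''e'', ''x'', ''y'', ''n'', ''m''} = {}" and R0: "sized R0"
    and init: "I {} M0"
    and edges: "\<And>X M. I X M \<Longrightarrow> holds_edges M"
    and step: "\<And>X x y R M. (x, y) \<in> parcs G \<Longrightarrow> R ''x'' = x \<Longrightarrow> R ''y'' = y \<Longrightarrow>
      (\<forall>r. r \<notin> {''e'', ''x'', ''y''} \<union> assigned c \<longrightarrow> R r = R0 r) \<Longrightarrow> I X M \<Longrightarrow>
      runs W c (R, M) (T x y) (\<lambda>s'. I (insert (x, y) X) (snd s'))"
    and post: "\<And>R M. (\<forall>r. r \<notin> {''e'', ''x'', ''y''} \<union> assigned c \<longrightarrow> R r = R0 r) \<Longrightarrow>
      I (parcs G) M \<Longrightarrow> Q (R, M)"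
    and time: "(\<Sum>e<m. T (fst (es ! e)) (snd (es ! e)) + T (snd (es ! e)) (fst (es ! e)))
      + 40 * m + 10 \<le> T'"
  shows "runs W (ForArcs c) (R0, M0) T' Q"
proof -
  let ?X = "\<lambda>k. \<Union>e<k. {(fst (es ! e), snd (es ! e)), (snd (es ! e), fst (es ! e))}"
  let ?T = "\<lambda>e. 28 + (T (fst (es ! e)) (snd (es ! e)) + T (snd (es ! e)) (fst (es ! e)))"
  let ?frame = "\<lambda>R. \<forall>r. r \<notin> {''e'', ''x'', ''y''} \<union> assigned c \<longrightarrow> R r = R0 r"
  have one: "runs W (Seq (load_arc i j) c) (R, M) (14 + T x y)
      (\<lambda>s'. I (insert (x, y) X) (snd s') \<and> ?frame (fst s') \<and> fst s' ''e'' = e)"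
    if "e < m" "R ''e'' = e" "?frame R" "I X M" "(x, y) \<in> parcs G"
      "M (2 * e + i) = x" "M (2 * e + j) = y" "i < 2" "j < 2" for e i j x y X R M
  proof (rule runs_Seq[where ?T1.0 = 14 and ?T2.0 = "T x y"])
    have xy: "x < n" "y < n" using arc_less that(5) by auto
    have ij: "2 * e + i < W" "2 * e + j < W" "e < W" "x < W" "y < W"
       "2 * e < W" "i < W" "j < W"
      using that xy W_large m_le by linarith+
    show "runs W (load_arc i j) (R, M) 14 (\<lambda>s'. s' = (R(''x'' := x, ''y'' := y), M))"
      unfolding load_arc_def by (intro runs_wp) (use that ij W_simps in auto)
  next
    fix s' assume s': "s' = (R(''x'' := x, ''y'' := y), M)"
    have "runs W c s' (T x y) (\<lambda>s'. I (insert (x, y) X) (snd s'))"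
      unfolding s' by (rule step) (use that in auto)
    then show "runs W c s' (T x y)
        (\<lambda>s'. I (insert (x, y) X) (snd s') \<and> ?frame (fst s') \<and> fst s' ''e'' = e)"
    proof (rule runs_mono[OF runs_frame])
      fix s'' assume "I (insert (x, y) X) (snd s'') \<and> (\<forall>r. r \<notin> assigned c \<longrightarrow> fst s'' r = fst s' r)"
      then show "I (insert (x, y) X) (snd s'') \<and> ?frame (fst s'') \<and> fst s'' ''e'' = e"
        using that(2,3) c unfolding s' by auto
    qed simp
  qed simp
  show ?thesis
    unfolding ForArcs_def
  proof (rule runs_For[where N = m and I = "\<lambda>k. I (?X k)" and T = ?T])
    have as: "assigned (Seq (Seq (load_arc 0 1) c) (Seq (load_arc 1 0) c)) = {''x'', ''y''} \<union> assigned c"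
      by (auto simp: load_arc_def)
    show "''e'' \<notin> assigned (Seq (Seq (load_arc 0 1) c) (Seq (load_arc 1 0) c))"
      using c unfolding as by auto
    show "aval (Reg ''m'') (R, M) = m \<and> afits W (Reg ''m'') (R, M)"
      if "\<forall>r. r \<notin> insert ''e'' (assigned (Seq (Seq (load_arc 0 1) c) (Seq (load_arc 1 0) c))) \<longrightarrow> R r = R0 r" for R M
      using that[rule_format, of "''m''"] c R0 W_simps unfolding as by auto
    show "m < W" "1 < W" using W_simps by auto
    show "I (?X 0) M0" using init by simp
    show "runs W (Seq (Seq (load_arc 0 1) c) (Seq (load_arc 1 0) c)) (R, M) (?T k)
          (\<lambda>s'. I (?X (Suc k)) (snd s'))"
      if k: "k < m" "R ''e'' = k" and fr: "\<forall>r. r \<notin> insert ''e'' (assigned (Seq (Seq (load_arc 0 1) c) (Seq (load_arc 1 0) c))) \<longrightarrow> R r = R0 r"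
        and I: "I (?X k) M" for k R M
    proof -
      have M: "M (2 * k) = fst (es ! k)" "M (2 * k + 1) = snd (es ! k)"
        using edges[OF I] k(1) by (auto simp: holds_edges_def)
      have fr': "?frame R" using fr unfolding as by auto
      have first: "runs W (Seq (load_arc 0 1) c) (R, M) (14 + T (fst (es ! k)) (snd (es ! k)))
        (\<lambda>t. I (insert (fst (es ! k), snd (es ! k)) (?X k)) (snd t)
          \<and> ?frame (fst t) \<and> fst t ''e'' = k)"
        by (rule one) (use k I fr' M arcs_es(1)[OF k(1)] in simp_all)
      show ?thesis
      proof (rule runs_Seq[OF first])
      fix s' assume s': "I (insert (fst (es ! k), snd (es ! k)) (?X k)) (snd s') \<and> ?frame (fst s') \<and> fst s' ''e'' = k"
      have M': "snd s' (2 * k) = fst (es ! k)" "snd s' (2 * k + 1) = snd (es ! k)"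
        using edges[of _ "snd s'"] s' k(1) by (auto simp: holds_edges_def)
      have "runs W (Seq (load_arc 1 0) c) (fst s', snd s') (14 + T (snd (es ! k)) (fst (es ! k)))
        (\<lambda>t. I (insert (snd (es ! k), fst (es ! k)) (insert (fst (es ! k), snd (es ! k)) (?X k))) (snd t)
          \<and> ?frame (fst t) \<and> fst t ''e'' = k)"
        by (rule one) (use k s' M' arcs_es(2)[OF k(1)] in simp_all)
      then show "runs W (Seq (load_arc 1 0) c) s' (14 + T (snd (es ! k)) (fst (es ! k)))
        (\<lambda>s'. I (?X (Suc k)) (snd s'))"
        unfolding prod.collapse
        by (rule runs_mono) (auto simp: lessThan_Suc insert_commute)
    qed simp
    qed
    show "Q (R, M)" if "\<forall>r. r \<notin> insert ''e'' (assigned (Seq (Seq (load_arc 0 1) c) (Seq (load_arc 1 0) c))) \<longrightarrow> R r = R0 r"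
       "I (?X m) M" for R M
      using post[of R M] that unfolding as parcs_es by auto
    show "sum ?T {..<m} + m * (acost (Reg ''m'') + 7) + (acost (Reg ''m'') + 5) \<le> T'"
      using time by (simp add: sum.distrib)
  qed
qed

end

context edge_list_input
begin

section \<open>Computing all distances\<close>

definition lowered :: "nat \<Rightarrow> nat \<Rightarrow> (nat \<Rightarrow> nat) \<Rightarrow> nat \<Rightarrow> nat" where
  "lowered a z M = (if z < M a then M(a := z) else M)"

definition raised :: "nat \<Rightarrow> nat \<Rightarrow> (nat \<Rightarrow> nat) \<Rightarrow> nat \<Rightarrow> nat" where
  "raised a z M = (if M a < z then M(a := z) else M)"

definition rows :: "nat \<Rightarrow> (nat \<Rightarrow> nat) \<Rightarrow> bool" where
  "rows u M \<longleftrightarrow> holds_edges M \<and> (\<forall>u'<u. \<forall>x<n. M (dist_cell u' x) = dist u' x)"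

text \<open>
  The state in round \<open>k\<close> for the source \<open>u\<close> after the arcs \<open>X\<close>: entries never drop below the
  distance, are exact up to distance \<open>k\<close>, and are also exact at distance \<open>k + 1\<close> as soon as the last
  arc of some shortest path has been treated. The relaxation in place may do better than that, which
  does no harm.
\<close>

definition bounded_row :: "nat \<Rightarrow> nat \<Rightarrow> (nat \<times> nat) set \<Rightarrow> (nat \<Rightarrow> nat) \<Rightarrow> bool" where
  "bounded_row u k X M \<longleftrightarrow> rows u M \<and> (\<forall>x<n. dist u x \<le> M (dist_cell u x) \<and> M (dist_cell u x) \<le> n \<and>
     (dist u x \<le> k \<longrightarrow> M (dist_cell u x) = dist u x) \<and>
     (\<forall>w. (w, x) \<in> X \<and> dist u w = k \<and> dist u x = Suc k \<longrightarrow> M (dist_cell u x) = Suc k))"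

lemma dist_le_n: "x < n \<Longrightarrow> y < n \<Longrightarrow> dist x y < n"
  using dist_less_card[of x y] verts by simp

lemma rows_upd:
  assumes "rows u M" "x < n" shows "rows u (M(dist_cell u x := z))"
  using assms dist_cell_bounds(1) by (auto simp: rows_def holds_edges_upd dist_cell_eq_iff)

lemma bounded_row_lowered:
  assumes M: "bounded_row u k X M" and xy: "(x, y) \<in> parcs G" and u: "u < n"
  shows "bounded_row u k (insert (x, y) X) (lowered (dist_cell u y) (M (dist_cell u x) + 1) M)"
proof -
  let ?M = "lowered (dist_cell u y) (M (dist_cell u x) + 1) M"
  have less: "x < n" "y < n" using arc_less[OF xy] by auto
  have R: "rows u M" and B: "\<And>z. z < n \<Longrightarrow> dist u z \<le> M (dist_cell u z) \<and> M (dist_cell u z) \<le> n \<and>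
     (dist u z \<le> k \<longrightarrow> M (dist_cell u z) = dist u z)"
    and C: "\<And>z w. z < n \<Longrightarrow> (w, z) \<in> X \<Longrightarrow> dist u w = k \<Longrightarrow> dist u z = Suc k \<Longrightarrow> M (dist_cell u z) = Suc k"
    using M by (auto simp: bounded_row_def)
  have other: "?M (dist_cell u z) = M (dist_cell u z)" if "z < n" "z \<noteq> y" for z
    using that less by (simp add: lowered_def dist_cell_eq_iff)
  have new: "?M (dist_cell u y) = min (M (dist_cell u y)) (M (dist_cell u x) + 1)"
    by (auto simp: lowered_def)
  have d: "dist u y \<le> dist u x + 1" using dist_arc[OF xy] u by simp
  have Y: "dist u y \<le> ?M (dist_cell u y) \<and> ?M (dist_cell u y) \<le> n \<and>
     (dist u y \<le> k \<longrightarrow> ?M (dist_cell u y) = dist u y)"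
    using B[OF less(1)] B[OF less(2)] d unfolding new by (auto simp: min_def)
  have Y': "?M (dist_cell u y) = Suc k" if "(w, y) \<in> insert (x, y) X" "dist u w = k" "dist u y = Suc k" for w
  proof (cases "w = x")
    case True
    then have "M (dist_cell u x) = k" using B[OF less(1)] that by simp
    then show ?thesis using Y that(3) unfolding new by linarith
  next
    case False
    then have "M (dist_cell u y) = Suc k" using C[OF less(2)] that by blast
    then show ?thesis using Y that(3) unfolding new by linarith
  qed
  have "rows u ?M" using rows_upd[OF R less(2)] R by (simp add: lowered_def)
  moreover have "dist u z \<le> ?M (dist_cell u z) \<and> ?M (dist_cell u z) \<le> n \<and>
     (dist u z \<le> k \<longrightarrow> ?M (dist_cell u z) = dist u z) \<and>
     (\<forall>w. (w, z) \<in> insert (x, y) X \<and> dist u w = k \<and> dist u z = Suc k \<longrightarrow> ?M (dist_cell u z) = Suc k)"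
    if z: "z < n" for z
  proof (cases "z = y")
    case True
    then show ?thesis using Y Y' by blast
  next
    case False
    then show ?thesis using B[OF z] C[OF z] unfolding other[OF z False] by blast
  qed
  ultimately show ?thesis unfolding bounded_row_def by blast
qed

lemma bounded_row_Suc:
  assumes M: "bounded_row u k (parcs G) M" and u: "u < n"
  shows "bounded_row u (Suc k) {} M"
proof -
  have "M (dist_cell u x) = dist u x" if x: "x < n" "dist u x \<le> Suc k" for x
  proof (cases "dist u x = Suc k")
    case True
    then obtain w where "(w, x) \<in> parcs G" "dist u w = k"
      using ex_previous[of u x k] u x by auto
    then show ?thesis using M True x unfolding bounded_row_def by metis
  next
    case False
    then show ?thesis using M x unfolding bounded_row_def by (simp add: le_Suc_eq)
  qed
  then show ?thesis using M unfolding bounded_row_def by blast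
qed

lemma runs_distances:
  assumes R0: "sized R0" and M0: "holds_edges M0"
    and post: "\<And>R M. (\<forall>r. r \<notin> {''u'', ''k'', ''e'', ''x'', ''y''} \<longrightarrow> R r = R0 r) \<Longrightarrow>
      rows n M \<Longrightarrow> Q (R, M)"
    and time: "n * (n * (140 * m + 60) + 100) + 6 \<le> T"
  shows "runs W distances (R0, M0) T Q"
proof -
  let ?relax = "lower (dist_exp ''u'' ''y'') (Plus (Load (dist_exp ''u'' ''x'')) (Const 1))"
  have relax: "runs W ?relax (R, M) 50 (\<lambda>s'. bounded_row u k (insert (x, y) X) (snd s'))"
    if "sized R" "R ''u'' = u" "u < n" "(x, y) \<in> parcs G" "R ''x'' = x" "R ''y'' = y"
      "bounded_row u k X M" for R M u k x y X
  proof (rule runs_wp)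
    have xy: "x < n" "y < n" using arc_less[OF that(4)] by auto
    then have M: "M (dist_cell u x) \<le> n" "M (dist_cell u y) \<le> n" using that(7) by (auto simp: bounded_row_def)
    then have fit: "Suc (M (dist_cell u x)) < W" "M (dist_cell u x) < W" "M (dist_cell u y) < W"
      using W_large by linarith+
    show "wp W ?relax (R, M) (\<lambda>s'. bounded_row u k (insert (x, y) X) (snd s'))"
      using bounded_row_lowered[OF that(7,4,3)] that xy fit
      by (simp add: lower_def lowered_def dist_cell_eval W_simps split: if_splits)
  qed (simp add: lower_def)
  have round: "runs W (ForArcs ?relax) (R, M) (140 * m + 10) (\<lambda>s'. bounded_row u (Suc k) {} (snd s'))"
    if "sized R" "R ''u'' = u" "u < n" "bounded_row u k {} M" for R M u k
  proof (rule runs_ForArcs[where I = "bounded_row u k" and T = "\<lambda>_ _. 50"])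
    show "holds_edges M" if "bounded_row u k X M" for X M using that by (simp add: bounded_row_def rows_def)
    show "runs W ?relax (R', M') 50 (\<lambda>s'. bounded_row u k (insert (x, y) X) (snd s'))"
      if "(x, y) \<in> parcs G" "R' ''x'' = x" "R' ''y'' = y"
      "\<forall>r. r \<notin> {''e'', ''x'', ''y''} \<union> assigned ?relax \<longrightarrow> R' r = R r" "bounded_row u k X M'"
      for X x y R' M'
      using that \<open>sized R\<close> \<open>R ''u'' = u\<close> \<open>u < n\<close> by (intro relax) auto
    show "bounded_row u (Suc k) {} (snd (R', M'))" if "bounded_row u k (parcs G) M'" for R' M'
      using bounded_row_Suc[OF that \<open>u < n\<close>] by simp
  qed (use that in auto)
  have init: "runs W (For ''x'' (Reg ''n'') (Store (dist_exp ''u'' ''x'') (Reg ''n''))) (R, M)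
      (n * 30 + 6) (\<lambda>s'. rows u (snd s') \<and> (\<forall>x<n. snd s' (dist_cell u x) = n))"
    if "sized R" "R ''u'' = u" "u < n" "rows u M" for R M u
  proof (rule runs_For_const[where N = n and T = 11 and
        I = "\<lambda>j M. rows u M \<and> (\<forall>x<j. M (dist_cell u x) = n)"])
    fix k R' M' assume k: "k < n" "R' ''x'' = k"
      "\<forall>r. r \<notin> insert ''x'' (assigned (Store (dist_exp ''u'' ''x'') (Reg ''n''))) \<longrightarrow> R' r = R r"
      "rows u M' \<and> (\<forall>x<k. M' (dist_cell u x) = n)"
    have "sized R'" "R' ''u'' = u" using k(3) that by auto
    then show "runs W (Store (dist_exp ''u'' ''x'') (Reg ''n'')) (R', M') 11
        (\<lambda>s'. rows u (snd s') \<and> (\<forall>x<Suc k. snd s' (dist_cell u x) = n))"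
      using k that rows_upd[of u M' k]
      by (intro runs_wp) (auto simp: dist_cell_eval W_simps less_Suc_eq dist_cell_eq_iff)
  qed (use that in \<open>auto simp: W_simps\<close>)
  have row: "runs W (Seq (For ''x'' (Reg ''n'') (Store (dist_exp ''u'' ''x'') (Reg ''n'')))
     (Seq (Store (dist_exp ''u'' ''u'') (Const 0)) (For ''k'' (Reg ''n'') (ForArcs ?relax))))
     (R, M) (n * (140 * m + 60) + 50) (\<lambda>s'. rows (Suc u) (snd s'))"
    if R: "sized R" "R ''u'' = u" and u: "u < n" and M: "rows u M" for R M u
  proof (rule runs_Seq[OF runs_frame[OF init[OF R u M]],
        where ?T2.0 = "n * (140 * m + 18) + 20"], goal_cases)
    case (1 s1)
    then have s1: "sized (fst s1)" "fst s1 ''u'' = u" "rows u (snd s1)" "\<forall>x<n. snd s1 (dist_cell u x) = n"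
      using R by auto
    have "runs W (Store (dist_exp ''u'' ''u'') (Const 0)) s1 11
      (\<lambda>s'. bounded_row u 0 {} (snd s') \<and> fst s' = fst s1)"
    proof (rule runs_wp)
      have "bounded_row u 0 {} ((snd s1)(dist_cell u u := 0))"
        using s1(3,4) u rows_upd[OF s1(3) u] dist_le_n[OF u] dist_eq_0D[of u]
        by (auto simp: bounded_row_def dist_cell_eq_iff intro: less_imp_le)
      then show "wp W (Store (dist_exp ''u'' ''u'') (Const 0)) s1
        (\<lambda>s'. bounded_row u 0 {} (snd s') \<and> fst s' = fst s1)"
        using s1 u by (cases s1) (auto simp: dist_cell_eval W_simps)
    qed simp
    then show ?case
    proof (rule runs_Seq[where ?T2.0 = "n * (140 * m + 18) + 6"], goal_cases)
      case (1 s2)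
      have "runs W (For ''k'' (Reg ''n'') (ForArcs ?relax)) (fst s2, snd s2) (n * (140 * m + 18) + 6)
        (\<lambda>s'. rows (Suc u) (snd s'))"
      proof (rule runs_For_const[where N = n and T = "140 * m + 10" and I = "\<lambda>k. bounded_row u k {}"])
        show "runs W (ForArcs ?relax) (R', M') (140 * m + 10) (\<lambda>s'. bounded_row u (Suc k) {} (snd s'))"
          if "\<forall>r. r \<notin> insert ''k'' (assigned (ForArcs ?relax)) \<longrightarrow> R' r = fst s2 r"
             "bounded_row u k {} M'" for k R' M'
          using that 1 s1 u by (intro round) auto
        show "rows (Suc u) (snd (R', M'))" if "bounded_row u n {} M'" for R' M'
          using that dist_le_n[OF u]
          by (auto simp: bounded_row_def rows_def less_Suc_eq intro: less_imp_le)
      qed (use 1 s1 W_simps in auto)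
      then show ?case by simp
    qed simp
  qed (simp add: algebra_simps)
  show ?thesis
    unfolding distances_def
  proof (rule runs_For_const[where N = n and T = "n * (140 * m + 60) + 50" and I = rows])
    show "n * (n * (140 * m + 60) + 50 + acost (Reg ''n'') + 7) + (acost (Reg ''n'') + 5) \<le> T"
      using time by (simp add: algebra_simps)
  next
    fix k R M assume k: "k < n" "R ''u'' = k" "rows k M" "\<forall>r. r \<notin> insert ''u''
      (assigned (Seq (For ''x'' (Reg ''n'') (Store (dist_exp ''u'' ''x'') (Reg ''n'')))
     (Seq (Store (dist_exp ''u'' ''u'') (Const 0)) (For ''k'' (Reg ''n'') (ForArcs ?relax))))) \<longrightarrow> R r = R0 r"
    have "sized R" using k(4) R0 by simp
    then show "runs W (Seq (For ''x'' (Reg ''n'') (Store (dist_exp ''u'' ''x'') (Reg ''n'')))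
     (Seq (Store (dist_exp ''u'' ''u'') (Const 0)) (For ''k'' (Reg ''n'') (ForArcs ?relax))))
     (R, M) (n * (140 * m + 60) + 50) (\<lambda>s'. rows (Suc k) (snd s'))"
      using k by (intro row) auto
  next
    fix R M assume "rows n M" "\<forall>r. r \<notin> insert ''u''
      (assigned (Seq (For ''x'' (Reg ''n'') (Store (dist_exp ''u'' ''x'') (Reg ''n'')))
     (Seq (Store (dist_exp ''u'' ''u'') (Const 0)) (For ''k'' (Reg ''n'') (ForArcs ?relax))))) \<longrightarrow> R r = R0 r"
    then show "Q (R, M)" by (intro post) auto
  qed (use R0 M0 in \<open>auto simp: W_simps rows_def\<close>)
qed

end

section \<open>Dynamic programming over isometric paths\<close>

text \<open>
  The next trend does not depend on the number of segments, and the next number is monotone in it.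
  This is why it suffices to store the maximal number for every trend.
\<close>

lemma advance_mono:
  "c \<le> c' \<Longrightarrow> fst (advance e (t, c)) = fst (advance e (t, c')) \<and>
    snd (advance e (t, c)) \<le> snd (advance e (t, c'))"
  by simp

context edge_list_input
begin

lemma raised_ge: "M b \<le> raised a z M b"
  by (simp add: raised_def)

lemma raised_self: "z \<le> raised a z M a"
  by (simp add: raised_def)

lemma raised_other: "b \<noteq> a \<Longrightarrow> raised a z M b = M b"
  by (simp add: raised_def)

lemma raised_cases: "raised a z M a = M a \<or> raised a z M a = z"
  by (simp add: raised_def)

lemma wp_raise:
  "afits W a (R, M) \<Longrightarrow> afits W b (R, M) \<Longrightarrow> M (aval a (R, M)) < W \<Longrightarrow>
    wp W (raise a b) (R, M) Q \<longleftrightarrow> Q (R, raised (aval a (R, M)) (aval b (R, M)) M)"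
  by (simp add: raise_def raised_def)

lemma rows_n_upd: "rows n M \<Longrightarrow> 2 * m + n * n \<le> a \<Longrightarrow> rows n (M(a := z))"
  using dist_cell_bounds(2) by (fastforce simp: rows_def holds_edges_upd)

lemma rows_n_raised: "rows n M \<Longrightarrow> 2 * m + n * n \<le> a \<Longrightarrow> rows n (raised a z M)"
  by (simp add: raised_def rows_n_upd)

text \<open>
  The paths in \<open>S v\<close> have been treated for the root \<open>v\<close>: the number stored for the root is at
  least their greedy number, and so is the table entry of their end and trend if they
  start in the current source \<open>s\<close>. Conversely, nothing is stored that is not attained by some
  path. This direction also bounds all entries by \<open>n\<close>, so that they fit into words.
\<close>

definition table :: "nat \<Rightarrow> (nat \<Rightarrow> nat list set) \<Rightarrow> (nat \<Rightarrow> nat) \<Rightarrow> bool" where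
  "table s S M \<longleftrightarrow> rows n M \<and>
     (\<forall>v<n. \<forall>p\<in>S v. snd (greedy (dist v) p) \<le> M (best_cell v) \<and>
        (last p = s \<longrightarrow>
          snd (greedy (dist v) p) \<le> M (table_cell v (hd p) (fst (greedy (dist v) p))))) \<and>
     (\<forall>v<n. \<exists>p. geodesic p \<and> snd (greedy (dist v) p) = M (best_cell v)) \<and>
     (\<forall>v<n. \<forall>y<n. \<forall>d<3. M (table_cell v y d) \<noteq> 0 \<longrightarrow>
        (\<exists>p. geodesic p \<and> hd p = y \<and> last p = s \<and> greedy (dist v) p = (d, M (table_cell v y d))))"

lemma tableD:
  assumes "table s S M"
  shows "rows n M"
    "\<And>v p. v < n \<Longrightarrow> p \<in> S v \<Longrightarrow> snd (greedy (dist v) p) \<le> M (best_cell v)"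
    "\<And>v p. v < n \<Longrightarrow> p \<in> S v \<Longrightarrow> last p = s \<Longrightarrow>
       snd (greedy (dist v) p) \<le> M (table_cell v (hd p) (fst (greedy (dist v) p)))"
    "\<And>v. v < n \<Longrightarrow> \<exists>p. geodesic p \<and> snd (greedy (dist v) p) = M (best_cell v)"
    "\<And>v y d. v < n \<Longrightarrow> y < n \<Longrightarrow> d < 3 \<Longrightarrow> M (table_cell v y d) \<noteq> 0 \<Longrightarrow>
       \<exists>p. geodesic p \<and> hd p = y \<and> last p = s \<and> greedy (dist v) p = (d, M (table_cell v y d))"
proof -
  note conj = assms[unfolded table_def]
  note conj2 = conjunct2[OF conj] and conj3 = conjunct2[OF conjunct2[OF conj]]
  show "rows n M" by (rule conjunct1[OF conj])
  show "snd (greedy (dist v) p) \<le> M (best_cell v)" if "v < n" "p \<in> S v" for v p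
    using conjunct1[OF conj2] that by blast
  show "snd (greedy (dist v) p) \<le> M (table_cell v (hd p) (fst (greedy (dist v) p)))"
    if "v < n" "p \<in> S v" "last p = s" for v p
    using conjunct1[OF conj2] that by blast
  show "\<exists>p. geodesic p \<and> snd (greedy (dist v) p) = M (best_cell v)" if "v < n" for v
    using conjunct1[OF conj3] that by blast
  show "\<exists>p. geodesic p \<and> hd p = y \<and> last p = s \<and> greedy (dist v) p = (d, M (table_cell v y d))"
    if "v < n" "y < n" "d < 3" "M (table_cell v y d) \<noteq> 0" for v y d
    using conjunct2[OF conj3, rule_format, OF that] .
qed

lemma table_mono:
  assumes M: "table s S M" and S: "\<And>v. v < n \<Longrightarrow> S' v \<subseteq> S v"
  shows "table s S' M"
  unfolding table_def
proof (intro conjI allI impI ballI)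
  fix v p assume v: "v < n" "p \<in> S' v"
  then have p: "p \<in> S v" using S by blast
  show "snd (greedy (dist v) p) \<le> M (best_cell v)" by (rule tableD(2)[OF M v(1) p])
  show "snd (greedy (dist v) p) \<le> M (table_cell v (hd p) (fst (greedy (dist v) p)))"
    if "last p = s" by (rule tableD(3)[OF M v(1) p that])
qed (rule tableD[OF M]; assumption)+

lemma greedy_le_n: "geodesic p \<Longrightarrow> v < n \<Longrightarrow> snd (greedy (dist v) p) \<le> n"
  using greedy_bounds(3)[of p v] geodesic_length_le[of p] verts by simp

lemma table_bounds:
  assumes "table s S M" "v < n"
  shows "M (best_cell v) \<le> n" "1 \<le> M (best_cell v)" "y < n \<Longrightarrow> d < 3 \<Longrightarrow> M (table_cell v y d) \<le> n"
    "x < n \<Longrightarrow> M (dist_cell v x) = dist v x"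
proof -
  obtain p where "geodesic p" "snd (greedy (dist v) p) = M (best_cell v)"
    using tableD(4)[OF assms] by blast
  then show "M (best_cell v) \<le> n" "1 \<le> M (best_cell v)"
    using greedy_le_n[of p v] assms(2) greedy_bounds(2)[of p v] by auto
  show "M (table_cell v y d) \<le> n" if yd: "y < n" "d < 3"
  proof (cases "M (table_cell v y d) = 0")
    case False
    then obtain p where "geodesic p" "greedy (dist v) p = (d, M (table_cell v y d))"
      using tableD(5)[OF assms yd] by blast
    then show ?thesis using greedy_le_n[of p v] assms(2) by simp
  qed simp
  show "M (dist_cell v x) = dist v x" if "x < n"
    using tableD(1)[OF assms(1)] assms(2) that by (simp add: rows_def)
qed

text \<open>
  The effect of the program \<open>extend\<close>, separated from its execution so that the preservation of the
  invariant is a statement about memories alone.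
\<close>

definition extend_memory :: "nat \<Rightarrow> nat \<Rightarrow> nat \<Rightarrow> nat \<Rightarrow> (nat \<Rightarrow> nat) \<Rightarrow> nat \<Rightarrow> nat" where
  "extend_memory v d x y M =
     (let c = M (table_cell v x d); fc = advance (M (dist_cell v y) + 1 - M (dist_cell v x)) (d, c)
      in if c = 0 then M else raised (best_cell v) (snd fc) (raised (table_cell v y (fst fc)) (snd fc) M))"

lemma runs_extend:
  assumes R: "sized R" "R ''v'' = v" "R ''d'' = d" "R ''x'' = x" "R ''y'' = y"
    and M: "table s S M" and v: "v < n" "d < 3" and xy: "(x, y) \<in> parcs G"
  shows "runs W extend (R, M) 200 (\<lambda>s'. snd s' = extend_memory v d x y M)"
proof (rule runs_wp)
  have less: "x < n" "y < n" using arc_less[OF xy] by auto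
  let ?c = "M (table_cell v x d)" and ?e = "Suc (M (dist_cell v y)) - M (dist_cell v x)"
  have D: "M (dist_cell v x) < n" "M (dist_cell v y) < n"
    using table_bounds(4)[OF M v(1)] less dist_le_n v by auto
  have e: "?e < 3"
    using table_bounds(4)[OF M v(1)] less dist_arc[OF xy, of v] v by simp
  have c: "?c \<le> n" by (rule table_bounds(3)[OF M v(1) less(1) v(2)])
  have F: "M (table_cell v y f) < W" if "f < 3" for f
    using table_bounds(3)[OF M v(1) less(2) that] W_simps(1) by blast
  have B: "M (best_cell v) < W" using table_bounds(1)[OF M v(1)] W_simps(1) by blast
  have fit: "M (dist_cell v x) < W" "M (dist_cell v y) < W" "Suc (M (dist_cell v y)) < W" "?c < W" "Suc ?c < W"
    "?e < W" "d < W" "x < W" "y < W" "v < W"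
    using D e c v less W_large by linarith+
  have FB: "raised (table_cell v y f) z M (best_cell v) = M (best_cell v)" if "f < 3" for f z
    using raised_other[of "best_cell v" "table_cell v y f"] table_cell_neq_best_cell[OF v(1) less(2) that, of v] by auto
  show "wp W extend (R, M) (\<lambda>s'. snd s' = extend_memory v d x y M)"
  proof (cases "?c = 0")
    case True
    then show ?thesis
      using R v less fit W_simps by (simp add: extend_def table_cell_eval extend_memory_def)
  next
    case False
    consider "?e = 1" | "?e \<noteq> 1" "d = 1" | "?e \<noteq> 1" "d \<noteq> 1" "d = ?e"
      | "?e \<noteq> 1" "d \<noteq> 1" "d \<noteq> ?e" by blast
    then show ?thesis
      using False R v less fit W_simps e F B FB
      by cases (simp_all add: extend_def table_cell_eval dist_cell_eval best_cell_eval extend_memory_def wp_raise Let_def)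
  qed
qed (simp add: extend_def raise_def)

text \<open>
  As \<open>y\<close> is one layer further from \<open>s\<close> than \<open>x\<close>, every isometric path from \<open>s\<close> to \<open>x\<close> extends to
  \<open>y\<close>. The entry \<open>c\<close> of \<open>x\<close> is attained by a path \<open>p0\<close>, and the values written are those of the
  extension of \<open>p0\<close>; by monotonicity they dominate the extensions of all other paths with trend \<open>d\<close>.
\<close>

lemma table_extend:
  assumes M: "table s S M" and s: "s < n" and v: "v < n" "d < 3" and xy: "(x, y) \<in> parcs G"
    and layer: "dist s y = Suc (dist s x)"
    and tails: "\<And>p. geodesic p \<Longrightarrow> hd p = x \<Longrightarrow> last p = s \<Longrightarrow> p \<in> S v"
  shows "table s (S(v := S v \<union> {y # p |p. geodesic p \<and> hd p = x \<and> last p = s \<and>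
      fst (greedy (dist v) p) = d})) (extend_memory v d x y M)"
proof -
  have less: "x < n" "y < n" using arc_less[OF xy] by auto
  let ?new = "{y # p |p. geodesic p \<and> hd p = x \<and> last p = s \<and> fst (greedy (dist v) p) = d}"
  define c where "c = M (table_cell v x d)"
  define e where "e = dist v y + 1 - dist v x"
  obtain f c' where fc: "advance e (d, c) = (f, c')" by fastforce
  have e_M: "M (dist_cell v y) + 1 - M (dist_cell v x) = e"
    using table_bounds(4)[OF M v(1)] less by (simp add: e_def)
  have count: "snd (greedy (dist v) p) \<le> c"
    if "geodesic p" "hd p = x" "last p = s" "fst (greedy (dist v) p) = d" for p
    using tableD(3)[OF M v(1) tails[OF that(1-3)] that(3)] that by (simp add: c_def)
  show ?thesis
  proof (cases "c = 0")
    case True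
    have empty: "?new = {}"
    proof (rule ccontr)
      assume "?new \<noteq> {}"
      then obtain p where p: "geodesic p" "hd p = x" "last p = s" "fst (greedy (dist v) p) = d"
        by blast
      show False using count[OF p] greedy_bounds(2)[OF p(1), of v] v True by simp
    qed
    have "extend_memory v d x y M = M"
      using True by (simp add: extend_memory_def c_def Let_def)
    then show ?thesis using M by (simp only: empty Un_empty_right fun_upd_triv)
  next
    case False
    let ?M1 = "raised (table_cell v y f) c' M"
    let ?M = "raised (best_cell v) c' ?M1"
    have M': "extend_memory v d x y M = ?M"
      using False fc e_M by (simp add: extend_memory_def c_def Let_def)
    obtain p0 where p0: "geodesic p0" "hd p0 = x" "last p0 = s" "greedy (dist v) p0 = (d, c)"
      using tableD(5)[OF M v(1) less(1) v(2)] False c_def by blast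
    have geo: "geodesic (y # p)" if "geodesic p" "hd p = x" "last p = s" for p
      using that xy arcs_symmetric layer dist_sym s less by (intro geodesic_ConsI) auto
    have runs: "greedy (dist v) (y # p) = advance e (greedy (dist v) p)"
      if "geodesic p" "hd p = x" for p
      using greedy_Cons[OF geodesic_nonempty[OF that(1)]] that(2) by (simp add: e_def)
    \<comment> \<open>the witness for both numbers that may be written\<close>
    have q0: "geodesic (y # p0)" "greedy (dist v) (y # p0) = (f, c')" "last (y # p0) = s"
      using geo runs p0 fc geodesic_nonempty by auto
    have f: "f < 3" using greedy_bounds(1)[OF q0(1), of v] q0(2) v by simp
    have ge: "M b \<le> ?M b" for b using raised_ge le_trans by blast
    have B: "?M (best_cell v') = M (best_cell v') \<or> v' = v \<and> ?M (best_cell v') = c'" if "v' < n" for v'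
    proof -
      have "?M1 (best_cell v') = M (best_cell v')" 
        using raised_other table_cell_neq_best_cell[OF v(1) less(2) f] by metis
      then show ?thesis
        using raised_other[of "best_cell v'" "best_cell v" c' ?M1] raised_cases[of "best_cell v" c' ?M1]
        by (cases "v' = v") (auto simp: best_cell_eq_iff)
    qed
    have F: "?M (table_cell v' y' d') = M (table_cell v' y' d') \<or>
        v' = v \<and> y' = y \<and> d' = f \<and> ?M (table_cell v' y' d') = c'"
      if "v' < n" "y' < n" "d' < 3" for v' y' d'
    proof -
      have "?M (table_cell v' y' d') = ?M1 (table_cell v' y' d')"
        using raised_other table_cell_neq_best_cell[OF that] by metis
      then show ?thesis
        using raised_other[of "table_cell v' y' d'" "table_cell v y f" c' M] raised_cases[of "table_cell v y f" c' M]
          table_cell_eq_iff[OF that(2) less(2) that(3) f, of v' v] by metis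
    qed
    have Fnew: "c' \<le> ?M (table_cell v y f)" using raised_self raised_ge le_trans by blast
    have Bnew: "c' \<le> ?M (best_cell v)" by (rule raised_self)
    have new: "fst (greedy (dist v) (y # p)) = f \<and> snd (greedy (dist v) (y # p)) \<le> c'"
      if "geodesic p" "hd p = x" "last p = s" "fst (greedy (dist v) p) = d" for p
    proof -
      have "greedy (dist v) p = (d, snd (greedy (dist v) p))" using that(4) by auto
      then show ?thesis
        using runs[OF that(1,2)] advance_mono[OF count[OF that], of e d] fc
        by (metis fst_conv snd_conv)
    qed
    show ?thesis
      unfolding M' table_def
    proof (intro conjI allI impI ballI)
      show "rows n ?M"
        using tableD(1)[OF M] table_cell_bounds(1) best_cell_bounds by (intro rows_n_raised) (auto intro: le_trans[OF _ best_cell_bounds])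
    next
      fix v' p assume v': "v' < n" and p: "p \<in> (S(v := S v \<union> ?new)) v'"
      show "snd (greedy (dist v') p) \<le> ?M (best_cell v')"
      proof (cases "p \<in> S v'")
        case True
        then show ?thesis using tableD(2)[OF M v'] ge le_trans by blast
      next
        case False
        then have "v' = v" "p \<in> ?new" using p by (auto split: if_splits)
        then show ?thesis using new Bnew le_trans by blast
      qed
      assume last: "last p = s"
      show "snd (greedy (dist v') p) \<le> ?M (table_cell v' (hd p) (fst (greedy (dist v') p)))"
      proof (cases "p \<in> S v'")
        case True
        then show ?thesis using tableD(3)[OF M v' _ last] ge le_trans by blast
      next
        case False
        then have "v' = v" "p \<in> ?new" using p by (auto split: if_splits)
        then obtain q where "p = y # q" "geodesic q" "hd q = x" "last q = s"
          "fst (greedy (dist v) q) = d" by blast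
        then show ?thesis using new[of q] Fnew \<open>v' = v\<close> by auto
      qed
    next
      fix v' assume "v' < n"
      then show "\<exists>p. geodesic p \<and> snd (greedy (dist v') p) = ?M (best_cell v')"
        using B[of v'] tableD(4)[OF M, of v'] q0 by (metis snd_conv)
    next
      fix v' y' d' assume a: "v' < n" "y' < n" "d' < (3::nat)"
      assume nz: "?M (table_cell v' y' d') \<noteq> 0"
      show "\<exists>p. geodesic p \<and> hd p = y' \<and> last p = s \<and>
          greedy (dist v') p = (d', ?M (table_cell v' y' d'))"
        using F[OF a]
      proof (elim disjE conjE)
        assume "?M (table_cell v' y' d') = M (table_cell v' y' d')"
        then show ?thesis using tableD(5)[OF M a] nz by simp
      next
        assume "v' = v" "y' = y" "d' = f" "?M (table_cell v' y' d') = c'"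
        then show ?thesis using q0 by (metis list.sel(1))
      qed
    qed
  qed
qed

definition settled :: "nat \<Rightarrow> nat \<Rightarrow> nat list set" where
  "settled s k = {p. geodesic p \<and> (last p < s \<or> last p = s \<and> length p \<le> k)}"

text \<open>
  While layer \<open>k\<close> of \<open>s\<close> is treated, the paths with \<open>k + 2\<close> vertices are settled according to their
  last arc.
\<close>

definition settled_arcs :: "nat \<Rightarrow> nat \<Rightarrow> (nat \<times> nat) set \<Rightarrow> nat list set" where
  "settled_arcs s k X = settled s (Suc k) \<union>
     {y # p |x y p. (x, y) \<in> X \<and> geodesic (y # p) \<and> geodesic p \<and> hd p = x \<and> last p = s \<and>
        length p = Suc k}"

lemma settled_arcs_empty: "settled_arcs s k {} = settled s (Suc k)"
  by (simp add: settled_arcs_def)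

lemma settled_arcs_all: "settled s (Suc (Suc k)) \<subseteq> settled_arcs s k (parcs G)"
proof
  fix p assume p: "p \<in> settled s (Suc (Suc k))"
  show "p \<in> settled_arcs s k (parcs G)"
  proof (cases "p \<in> settled s (Suc k)")
    case False
    then have g: "geodesic p" "last p = s" "length p = Suc (Suc k)"
      using p by (auto simp: settled_def)
    then obtain y x q where q: "p = y # x # q" by (metis length_Suc_conv)
    note d = geodesic_ConsD[OF g(1)[unfolded q]]
    have "(x, y) \<in> parcs G \<and> geodesic (y # x # q) \<and> geodesic (x # q) \<and> hd (x # q) = x \<and>
      last (x # q) = s \<and> length (x # q) = Suc k"
      using g d q arcs_symmetric by simp
    then show ?thesis unfolding settled_arcs_def q by blast
  qed (simp add: settled_arcs_def)
qed

text \<open>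
  The time bound keeps the test whether \<open>(x, y)\<close> leads from layer \<open>k\<close> to the next one, since only
  then all roots have to be treated. If it does not, it is the last arc of no path from \<open>s\<close> with
  \<open>k + 2\<close> vertices.
\<close>

lemma runs_extend_all:
  assumes R0: "sized R0" "R0 ''s'' = s" "R0 ''k'' = k" "R0 ''x'' = x" "R0 ''y'' = y"
    and s: "s < n" "k < n" and xy: "(x, y) \<in> parcs G"
    and M0: "table s (\<lambda>_. settled_arcs s k X) M0"
  shows "runs W extend_all (R0, M0)
    (70 + (if dist s x = k \<and> dist s y = Suc k then 700 * n + 10 else 0))
    (\<lambda>s'. table s (\<lambda>_. settled_arcs s k (insert (x, y) X)) (snd s'))"
proof -
  have less: "x < n" "y < n" using arc_less[OF xy] by auto
  let ?guard = "BAnd (Eq (Load (dist_exp ''s'' ''x'')) (Reg ''k''))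
                      (Eq (Load (dist_exp ''s'' ''y'')) (Plus (Reg ''k'') (Const 1)))"
  have D: "M0 (dist_cell s x) = dist s x" "M0 (dist_cell s y) = dist s y"
    using table_bounds(4)[OF M0 s(1)] less by auto
  have fit: "dist s x < W" "dist s y < W" "k < W" "Suc k < W"
    using dist_le_n[OF s(1)] less s W_large by (meson W_simps less_imp_le, meson W_simps less_imp_le, linarith+)
  have guard: "bval ?guard (R0, M0) \<longleftrightarrow> dist s x = k \<and> dist s y = Suc k" "bfits W ?guard (R0, M0)"
    using R0 s less D fit W_simps by (auto simp: dist_cell_eval)
  have cost: "bcost ?guard = 59" by simp
  let ?tails = "{y # p |p. geodesic p \<and> hd p = x \<and> last p = s}"
  have old: "table s (\<lambda>_. settled_arcs s k (insert (x, y) X)) M0"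
    if "\<not> (dist s x = k \<and> dist s y = Suc k)"
  proof (rule table_mono[OF M0])
    have "\<not> (geodesic (y # p) \<and> geodesic p \<and> hd p = x \<and> last p = s \<and> length p = Suc k)" for p
    proof
      assume p: "geodesic (y # p) \<and> geodesic p \<and> hd p = x \<and> last p = s \<and> length p = Suc k"
      then have "dist x s = k" "dist y s = Suc k" using geodesic_nonempty[of p] by (auto simp: geodesic_def)
      then show False using that dist_sym s less by auto
    qed
    then show "settled_arcs s k (insert (x, y) X) \<subseteq> settled_arcs s k X"
      unfolding settled_arcs_def by blast
  qed
  show ?thesis
    unfolding extend_all_def
  proof (rule runs_Cond[where ?T1.0 = "700 * n + 6" and ?T2.0 = 1, OF guard(2)])
    assume "bval ?guard (R0, M0)"
    then have layer: "dist s x = k" "dist s y = Suc (dist s x)" using guard(1) by auto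
    have in_settled: "p \<in> settled_arcs s k X" if "geodesic p" "hd p = x" "last p = s" for p
    proof -
      have "length p = Suc k" using that layer dist_sym s less by (simp add: geodesic_def)
      then show ?thesis using that by (simp add: settled_arcs_def settled_def)
    qed
    let ?S = "\<lambda>j v. settled_arcs s k X \<union> (if v < j then ?tails else {})"
    show "runs W (For ''v'' (Reg ''n'') (For ''d'' (Const 3) extend)) (R0, M0) (700 * n + 6)
      (\<lambda>s'. table s (\<lambda>_. settled_arcs s k (insert (x, y) X)) (snd s'))"
    proof (rule runs_For_const[where N = n and T = 650 and I = "\<lambda>j M. table s (?S j) M"])
      fix v R M assume v: "v < n" "R ''v'' = v" "table s (?S v) M"
        "\<forall>r. r \<notin> insert ''v'' (assigned (For ''d'' (Const 3) extend)) \<longrightarrow> R r = R0 r"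
      have R: "sized R" "R ''x'' = x" "R ''y'' = y" using R0 v(4) by auto
      let ?D = "\<lambda>i. (?S v)(v := ?S v v \<union> {y # p |p. geodesic p \<and> hd p = x \<and> last p = s \<and>
         fst (greedy (dist v) p) < i})"
      show "runs W (For ''d'' (Const 3) extend) (R, M) 650 (\<lambda>s'. table s (?S (Suc v)) (snd s'))"
      proof (rule runs_For_const[where N = 3 and T = 200 and I = "\<lambda>i M. table s (?D i) M"])
        fix d R' M' assume d: "d < 3" "R' ''d'' = d" "table s (?D d) M'"
          "\<forall>r. r \<notin> insert ''d'' (assigned extend) \<longrightarrow> R' r = R r"
        have R': "sized R'" "R' ''x'' = x" "R' ''y'' = y" "R' ''v'' = v" using R v d(4) by auto
        have "table s ((?D d)(v := ?D d v \<union> {y # p |p. geodesic p \<and> hd p = x \<and> last p = s \<and>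
           fst (greedy (dist v) p) = d})) (extend_memory v d x y M')"
          by (rule table_extend[OF d(3) s(1) v(1) d(1) xy layer(2)]) (simp add: in_settled)
        then have "table s (?D (Suc d)) (extend_memory v d x y M')"
          by (rule table_mono) (auto simp: less_Suc_eq)
        then show "runs W extend (R', M') 200 (\<lambda>s'. table s (?D (Suc d)) (snd s'))"
          by (intro runs_mono[OF runs_extend[OF R'(1,4) d(2) R'(2,3) d(3) v(1) d(1) xy]]) simp_all
      next
        show "table s (?D 0) M" using v(3) by (rule table_mono) auto
      next
        fix R' M' assume t: "table s (?D 3) M'"
        have "table s (?S (Suc v)) M'"
        proof (rule table_mono[OF t])
          show "?S (Suc v) w \<subseteq> ?D 3 w" for w
            using greedy_bounds(1)[of _ v] v(1) by (auto simp: less_Suc_eq)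
        qed
        then show "table s (?S (Suc v)) (snd (R', M'))" by simp
      qed (use W_simps in auto)
    next
      show "table s (?S 0) M0" using M0 by simp
    next
      fix R M assume "table s (?S n) M"
      then have "table s (\<lambda>_. settled_arcs s k (insert (x, y) X)) M"
        by (rule table_mono) (auto simp: settled_arcs_def)
      then show "table s (\<lambda>_. settled_arcs s k (insert (x, y) X)) (snd (R, M))" by simp
    qed (use R0 W_simps in auto)
  next
    assume "\<not> bval ?guard (R0, M0)"
    then show "runs W Skip (R0, M0) 1 (\<lambda>s'. table s (\<lambda>_. settled_arcs s k (insert (x, y) X)) (snd s'))"
      using old guard(1) by (intro runs_wp) auto
  qed (simp only: guard(1) cost, simp)
qed

definition best :: "nat \<Rightarrow> (nat \<Rightarrow> nat) \<Rightarrow> bool" where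
  "best s M \<longleftrightarrow> rows n M \<and>
     (\<forall>v<n. \<exists>p. geodesic p \<and> snd (greedy (dist v) p) = M (best_cell v)) \<and>
     (\<forall>v<n. \<forall>p. geodesic p \<and> last p < s \<longrightarrow> snd (greedy (dist v) p) \<le> M (best_cell v))"

lemma best_upd:
  assumes M: "best s M" and a: "2 * m + n * n \<le> a" "a < 2 * m + 4 * (n * n)"
  shows "best s (M(a := z))"
proof -
  have "(M(a := z)) (best_cell v) = M (best_cell v)" for v using a(2) best_cell_bounds[of v] by auto
  then show ?thesis using M rows_n_upd[OF _ a(1)] unfolding best_def by simp
qed

lemma runs_clear:
  assumes R0: "sized R0" "R0 ''s'' = s" and s: "s < n" and M0: "best s M0"
  shows "runs W clear (R0, M0) (69 * (n * n) + 27 * n + 16)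
    (\<lambda>s'. table s (\<lambda>_. settled s 1) (snd s'))"
  unfolding clear_def
proof (rule runs_Seq)
  let ?zeros = "\<lambda>q M. best s M \<and> (\<forall>j<q. M (2 * m + n * n + j) = 0)"
  let ?zero = "Store (Plus table_base_exp (Reg ''q'')) (Const 0)"
  show "runs W (For ''q'' (Times (Const 3) (Times (Reg ''n'') (Reg ''n''))) ?zero)
     (R0, M0) (69 * (n * n) + 10) (\<lambda>s'. ?zeros (3 * (n * n)) (snd s') \<and> sized (fst s') \<and> fst s' ''s'' = s)"
  proof (rule runs_For_const[where N = "3 * (n * n)" and T = 11 and I = ?zeros])
    fix q R M assume q: "q < 3 * (n * n)" "R ''q'' = q" "?zeros q M"
      "\<forall>r. r \<notin> insert ''q'' (assigned ?zero) \<longrightarrow> R r = R0 r"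
    have R: "sized R" using R0 q(4) by simp
    have "2 * m + n * n + q < W" "q < W" using q(1) W_large m_le by linarith+
    moreover have "?zeros (Suc q) (M(2 * m + n * n + q := 0))"
      using best_upd[of s M "2 * m + n * n + q" 0] q(1,3) by (auto simp: less_Suc_eq)
    ultimately show "runs W ?zero (R, M) 11 (\<lambda>s'. ?zeros (Suc q) (snd s'))"
      using q(2) R by (intro runs_wp) (simp_all add: table_base_eval W_simps)
  qed (use R0 M0 in \<open>auto simp: W_simps\<close>)
  fix s1 :: state
  assume s1: "?zeros (3 * (n * n)) (snd s1) \<and> sized (fst s1) \<and> fst s1 ''s'' = s"
  let ?start = "\<lambda>j M. best s M \<and> (\<forall>v<n. \<forall>y<n. \<forall>d<3.
      M (table_cell v y d) = (if v < j \<and> y = s \<and> d = 1 then 1 else 0))"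
  let ?set = "Store (table_exp ''v'' ''s'' (Const 1)) (Const 1)"
  have "runs W (For ''v'' (Reg ''n'') ?set) (fst s1, snd s1) (27 * n + 6)
    (\<lambda>s'. table s (\<lambda>_. settled s 1) (snd s'))"
  proof (rule runs_For_const[where N = n and T = 19 and I = ?start])
    have "3 * (v * n + y) + d < 3 * (n * n)" if "v < n" "y < n" "d < 3" for v y d
    proof -
      have "3 * i + d < 3 * j" if "i < j" for i j using that \<open>d < 3\<close> by simp
      then show ?thesis using index_less[OF that(1,2)] .
    qed
    then show "?start 0 (snd s1)" using s1 by (simp add: table_cell_def)
  next
    fix v R M assume v: "v < n" "R ''v'' = v" "?start v M"
      "\<forall>r. r \<notin> insert ''v'' (assigned ?set) \<longrightarrow> R r = fst s1 r"
    have R: "sized R" "R ''s'' = s" using s1 v(4) by auto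
    have "best s (M(table_cell v s 1 := 1))"
      using v(1,3) s table_cell_bounds by (intro best_upd) auto
    moreover have "(M(table_cell v s 1 := 1)) (table_cell v' y d) = (if v' < Suc v \<and> y = s \<and> d = 1 then 1 else 0)"
      if "v' < n" "y < n" "d < 3" for v' y d
    proof (cases "table_cell v' y d = table_cell v s 1")
      case True
      then have "v' = v \<and> y = s \<and> d = 1" using table_cell_eq_iff[of y s d 1 v' v] that s by simp
      then show ?thesis by simp
    next
      case False
      then have "\<not> (v' = v \<and> y = s \<and> d = 1)" by blast
      then show ?thesis using False v(3) that by (auto simp: less_Suc_eq)
    qed
    ultimately show "runs W ?set (R, M) 19 (\<lambda>s'. ?start (Suc v) (snd s'))"
      using R v(1,2) s by (intro runs_wp) (simp_all add: table_cell_eval W_simps)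
  next
    fix R M assume M: "?start n M"
    have single: "p = [s]" if "p \<in> settled s 1" "\<not> last p < s" for p
      using that geodesic_nonempty[of p] by (cases p) (auto simp: settled_def)
    have "table s (\<lambda>_. settled s 1) M"
      unfolding table_def
    proof (intro conjI allI impI ballI)
      fix v p assume v: "v < n" and p: "p \<in> settled s 1"
      show "snd (greedy (dist v) p) \<le> M (best_cell v)"
      proof (cases "last p < s")
        case True
        then show ?thesis using M v p by (auto simp: best_def settled_def)
      next
        case False
        obtain q where "geodesic q" "snd (greedy (dist v) q) = M (best_cell v)"
          using M v unfolding best_def by blast
        then show ?thesis using single[OF p False] greedy_bounds(2)[of q v] v by simp
      qed
      show "snd (greedy (dist v) p) \<le> M (table_cell v (hd p) (fst (greedy (dist v) p)))" if "last p = s"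
        using single[OF p] that M v s by simp
    next
      show "rows n M" using M by (simp add: best_def)
    next
      fix v assume "v < n"
      then show "\<exists>p. geodesic p \<and> snd (greedy (dist v) p) = M (best_cell v)"
        using M by (simp add: best_def)
    next
      fix v y d assume a: "v < n" "y < n" "d < (3::nat)" "M (table_cell v y d) \<noteq> 0"
      then have eq: "M (table_cell v y d) = (if v < n \<and> y = s \<and> d = 1 then 1 else 0)" using M by blast
      then have yd: "y = s" "d = 1" using a(4) by presburger+
      show "\<exists>p. geodesic p \<and> hd p = y \<and> last p = s \<and> greedy (dist v) p = (d, M (table_cell v y d))"
        using eq a(1) s unfolding yd by (intro exI[of _ "[s]"]) (simp add: geodesic_single)
    qed
    then show "table s (\<lambda>_. settled s 1) (snd (R, M))" by simp
  qed (use s1 W_simps in auto)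
  then show "runs W (For ''v'' (Reg ''n'') ?set) s1 (27 * n + 6)
    (\<lambda>s'. table s (\<lambda>_. settled s 1) (snd s'))" by simp
qed simp

lemma best_of_table:
  assumes "table s (\<lambda>_. settled s (Suc n)) M"
  shows "best (Suc s) M"
proof -
  have "snd (greedy (dist v) p) \<le> M (best_cell v)" if v: "v < n" and p: "geodesic p" "last p < Suc s" for v p
  proof (rule tableD(2)[OF assms v])
    show "p \<in> settled s (Suc n)"
      using p geodesic_length_le[OF p(1)] verts by (auto simp: settled_def)
  qed
  then show ?thesis using tableD(1,4)[OF assms] unfolding best_def by blast
qed

text \<open>
  An arc leaves a single layer, so its expensive treatment is paid for once in all \<open>n\<close> scans.
\<close>

lemma sum_single_layer: "(\<Sum>k<N. if a = k \<and> b = Suc k then c else (0::nat)) \<le> c"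
proof -
  have "(\<Sum>k<N. if a = k \<and> b = Suc k then c else 0) \<le> (\<Sum>k<N. if a = k then c else 0)"
    by (intro sum_mono) simp
  also have "\<dots> \<le> c" by (simp add: sum.delta)
  finally show ?thesis .
qed

lemma runs_cover_numbers:
  assumes R0: "sized R0" and M0: "rows n M0"
    and post: "\<And>R M. sized R \<Longrightarrow> best n M \<Longrightarrow> Q (R, M)"
    and time: "n * (1600 * (n * m) + 69 * (n * n) + 45 * n + 40) + 21 * n + 12 \<le> T"
  shows "runs W cover_numbers (R0, M0) T Q"
  unfolding cover_numbers_def
proof (rule runs_Seq)
  let ?one = "Store (best_exp ''v'') (Const 1)"
  let ?ones = "\<lambda>j M. rows n M \<and> (\<forall>v<j. M (best_cell v) = 1)"
  show "runs W (For ''v'' (Reg ''n'') ?one) (R0, M0) (21 * n + 6) (\<lambda>s'. best 0 (snd s') \<and> sized (fst s'))"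
  proof (rule runs_For_const[where N = n and T = 13 and I = ?ones])
    fix v R M assume v: "v < n" "R ''v'' = v" "?ones v M"
      "\<forall>r. r \<notin> insert ''v'' (assigned ?one) \<longrightarrow> R r = R0 r"
    have R: "sized R" using R0 v(4) by auto
    have "2 * m + n * n \<le> best_cell v" by (rule le_trans[OF _ best_cell_bounds]) simp
    then have "?ones (Suc v) (M(best_cell v := 1))" using v(3) rows_n_upd by (auto simp: less_Suc_eq best_cell_eq_iff)
    then show "runs W ?one (R, M) 13 (\<lambda>s'. ?ones (Suc v) (snd s'))"
      using R v(1,2) by (intro runs_wp) (simp_all add: best_cell_eval W_simps)
  next
    fix R M assume R: "\<forall>r. r \<notin> insert ''v'' (assigned ?one) \<longrightarrow> R r = R0 r" and M: "?ones n M"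
    have "\<exists>p. geodesic p \<and> snd (greedy (dist v) p) = M (best_cell v)" if "v < n" for v
      using M that by (intro exI[of _ "[v]"]) (simp add: geodesic_single)
    then show "best 0 (snd (R, M)) \<and> sized (fst (R, M))" using M R R0 by (simp add: best_def)
  qed (use R0 M0 W_simps in auto)
  fix s1 assume s1: "best 0 (snd s1) \<and> sized (fst s1)"
  let ?body = "Seq clear (For ''k'' (Reg ''n'') (ForArcs extend_all))"
  let ?B = "1600 * (n * m) + 69 * (n * n) + 45 * n + 22"
  have "runs W (For ''s'' (Reg ''n'') ?body) (fst s1, snd s1) (n * (?B + 8) + 6) Q"
  proof (rule runs_For_const[where N = n and T = ?B and I = best])
    fix s R M assume s: "s < n" "R ''s'' = s" "best s M"
      "\<forall>r. r \<notin> insert ''s'' (assigned ?body) \<longrightarrow> R r = fst s1 r"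
    have R: "sized R" using s1 s(4) by auto
    show "runs W ?body (R, M) ?B (\<lambda>s'. best (Suc s) (snd s'))"
    proof (rule runs_Seq[OF runs_frame[OF runs_clear[OF R s(2,1,3)]]])
      fix s2 assume s2: "table s (\<lambda>_. settled s 1) (snd s2) \<and>
         (\<forall>r. r \<notin> assigned clear \<longrightarrow> fst s2 r = fst (R, M) r)"
      have R2: "sized (fst s2)" "fst s2 ''s'' = s" using s2 R s(2) by auto
      define C where "C = (\<lambda>k x y. 70 + (if dist s x = k \<and> dist s y = Suc k then 700 * n + 10 else 0))"
      let ?T = "\<lambda>k. (\<Sum>e<m. C k (fst (es ! e)) (snd (es ! e)) + C k (snd (es ! e)) (fst (es ! e)))
         + 40 * m + 10"
      have C: "(\<Sum>k<n. C k x y) \<le> 770 * n + 10" for x y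
        using sum_single_layer[of "dist s x" "dist s y" "700 * n + 10" n]
        by (simp add: C_def sum.distrib)
      \<comment> \<open>exchanging the sums charges the expensive steps to the arcs instead of the layers\<close>
      have "(\<Sum>k<n. \<Sum>e<m. C k (fst (es ! e)) (snd (es ! e)) + C k (snd (es ! e)) (fst (es ! e)))
        = (\<Sum>e<m. (\<Sum>k<n. C k (fst (es ! e)) (snd (es ! e))) + (\<Sum>k<n. C k (snd (es ! e)) (fst (es ! e))))"
        by (subst sum.swap) (simp add: sum.distrib)
      also have "\<dots> \<le> (\<Sum>e<m. (770 * n + 10) + (770 * n + 10))"
        by (intro sum_mono add_mono C)
      also have "\<dots> = m * (1540 * n + 20)" by simp
      finally have "(\<Sum>k<n. ?T k) \<le> m * (1540 * n + 20) + n * (40 * m + 10)"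
        by (simp add: sum.distrib algebra_simps)
      also have "\<dots> \<le> 1600 * (n * m) + 10 * n"
      proof -
        have "m * 1 \<le> m * n" using n_pos by (intro mult_left_mono) auto
        then show ?thesis by (simp add: algebra_simps)
      qed
      finally have cost: "(\<Sum>k<n. ?T k) + n * 8 + 6 \<le> 1600 * (n * m) + 18 * n + 6"
        by linarith
      have "runs W (For ''k'' (Reg ''n'') (ForArcs extend_all)) (fst s2, snd s2)
         (1600 * (n * m) + 18 * n + 6) (\<lambda>s'. best (Suc s) (snd s'))"
      proof (rule runs_For[where N = n and T = ?T and I = "\<lambda>k. table s (\<lambda>_. settled s (Suc k))"])
        fix k R M assume k: "k < n" "R ''k'' = k" "table s (\<lambda>_. settled s (Suc k)) M"
          "\<forall>r. r \<notin> insert ''k'' (assigned (ForArcs extend_all)) \<longrightarrow> R r = fst s2 r"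
        have R: "sized R" "R ''s'' = s" using R2 k(4) by auto
        show "runs W (ForArcs extend_all) (R, M) (?T k) (\<lambda>s'. table s (\<lambda>_. settled s (Suc (Suc k))) (snd s'))"
        proof (rule runs_ForArcs[where T = "C k" and I = "\<lambda>X. table s (\<lambda>_. settled_arcs s k X)"])
          show "table s (\<lambda>_. settled_arcs s k {}) M" using k(3) by (simp only: settled_arcs_empty)
          show "holds_edges M" if "table s (\<lambda>_. settled_arcs s k X) M" for X M
            using tableD(1)[OF that] by (simp add: rows_def)
          show "runs W extend_all (R', M') (C k x y) (\<lambda>s'. table s (\<lambda>_. settled_arcs s k (insert (x, y) X)) (snd s'))"
            if "(x, y) \<in> parcs G" "R' ''x'' = x" "R' ''y'' = y"
              "\<forall>r. r \<notin> {''e'', ''x'', ''y''} \<union> assigned extend_all \<longrightarrow> R' r = R r"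
              "table s (\<lambda>_. settled_arcs s k X) M'" for X x y R' M'
            unfolding C_def using that R k(1,2) s(1) by (intro runs_extend_all) auto
          show "table s (\<lambda>_. settled s (Suc (Suc k))) (snd (R', M'))"
            if "table s (\<lambda>_. settled_arcs s k (parcs G)) M'" for R' M'
            using table_mono[OF that settled_arcs_all] by simp
        qed (use R in auto)
      next
        show "best (Suc s) (snd (R, M))" if "table s (\<lambda>_. settled s (Suc n)) M" for R M
          using best_of_table[OF that] by simp
        show "(\<Sum>k<n. ?T k) + n * (acost (Reg ''n'') + 7) + (acost (Reg ''n'') + 5)
          \<le> 1600 * (n * m) + 18 * n + 6"
          using cost by simp
      qed (use s2 R2 W_simps in auto)
      then show "runs W (For ''k'' (Reg ''n'') (ForArcs extend_all)) s2
         (1600 * (n * m) + 18 * n + 6) (\<lambda>s'. best (Suc s) (snd s'))" by simp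
    qed simp
  next
    show "Q (R, M)" if "\<forall>r. r \<notin> insert ''s'' (assigned ?body) \<longrightarrow> R r = fst s1 r" "best n M" for R M
      using that s1 by (intro post) auto
  qed (use s1 W_simps in auto)
  then show "runs W (For ''s'' (Reg ''n'') ?body) s1 (n * (?B + 8) + 6) Q" by simp
qed (use time in \<open>simp add: algebra_simps\<close>)

lemma wp_lower:
  "afits W a (R, M) \<Longrightarrow> afits W b (R, M) \<Longrightarrow> M (aval a (R, M)) < W \<Longrightarrow>
    wp W (lower a b) (R, M) Q \<longleftrightarrow> Q (R, lowered (aval a (R, M)) (aval b (R, M)) M)"
  by (simp add: lower_def lowered_def)

text \<open>
  The numbers of the roots are at most \<open>n\<close>, so \<open>n\<close> is a correct start value for the minimum: if it
  survives, then all numbers are equal to \<open>n\<close>.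
\<close>

lemma runs_minimum:
  assumes R0: "sized R0" and M0: "\<And>v. v < n \<Longrightarrow> M0 (best_cell v) \<le> n"
  shows "runs W minimum (R0, M0) (60 * n + 40)
    (\<lambda>s'. (\<forall>v<n. fst s' ''out'' \<le> M0 (best_cell v)) \<and> (\<exists>v<n. M0 (best_cell v) = fst s' ''out''))"
proof -
  let ?inv = "\<lambda>j M. (\<forall>v<n. M (best_cell v) = M0 (best_cell v)) \<and> M (best_cell n) \<le> n \<and>
    (\<forall>v<j. M (best_cell n) \<le> M0 (best_cell v)) \<and> (M (best_cell n) = n \<or> (\<exists>v<n. M0 (best_cell v) = M (best_cell n)))"
  let ?step = "lower (best_exp ''n'') (Load (best_exp ''v''))"
  have 1: "runs W (Store (best_exp ''n'') (Reg ''n'')) (R0, M0) 13 (\<lambda>s'. ?inv 0 (snd s') \<and> sized (fst s'))"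
    using R0 by (intro runs_wp) (auto simp: best_cell_eval W_simps best_cell_eq_iff)
  have 2: "runs W (For ''v'' (Reg ''n'') ?step) s1 (58 * n + 6) (\<lambda>s'. ?inv n (snd s') \<and> sized (fst s'))"
    if s1: "?inv 0 (snd s1) \<and> sized (fst s1)" for s1
  proof -
    have "runs W (For ''v'' (Reg ''n'') ?step) (fst s1, snd s1) (58 * n + 6)
      (\<lambda>s'. ?inv n (snd s') \<and> sized (fst s'))"
    proof (rule runs_For_const[where N = n and T = 50 and I = ?inv])
      fix v R M assume v: "v < n" "R ''v'' = v" "?inv v M"
        "\<forall>r. r \<notin> insert ''v'' (assigned ?step) \<longrightarrow> R r = fst s1 r"
      have R: "sized R" using s1 v(4) by auto
      have le: "M (best_cell v) \<le> n" "M (best_cell n) \<le> n" using v(1,3) M0 by auto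
      have "?inv (Suc v) (lowered (best_cell n) (M (best_cell v)) M)"
      proof (cases "M (best_cell v) < M (best_cell n)")
        case True
        then show ?thesis using v(1,3) le by (auto simp: lowered_def best_cell_eq_iff less_Suc_eq intro: le_trans)
      next
        case False
        then show ?thesis using v(1,3) by (auto simp: lowered_def less_Suc_eq)
      qed
      then show "runs W ?step (R, M) 50 (\<lambda>s'. ?inv (Suc v) (snd s'))"
        using R v(1,2) le W_simps(1) by (intro runs_wp) (simp add: wp_lower best_cell_eval, simp add: lower_def)
    next
      show "?inv 0 (snd s1)" using s1 by blast
    next
      show "?inv n (snd (R, M)) \<and> sized (fst (R, M))" if "?inv n M"
        "\<forall>r. r \<notin> insert ''v'' (assigned ?step) \<longrightarrow> R r = fst s1 r" for R M
        using that s1 by simp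
    qed (use s1 W_simps in auto)
    then show ?thesis by simp
  qed
  have 3: "runs W (Assign ''out'' (Load (best_exp ''n''))) s2 13
    (\<lambda>s'. (\<forall>v<n. fst s' ''out'' \<le> M0 (best_cell v)) \<and> (\<exists>v<n. M0 (best_cell v) = fst s' ''out''))"
    if s2: "?inv n (snd s2) \<and> sized (fst s2)" for s2
  proof -
    have "\<exists>v<n. M0 (best_cell v) = snd s2 (best_cell n)"
    proof (cases "snd s2 (best_cell n) = n")
      case True
      then have "M0 (best_cell 0) = n" using s2 M0[OF n_pos] n_pos by (metis le_antisym)
      then show ?thesis using True n_pos by metis
    next
      case False
      then show ?thesis using s2 by blast
    qed
    moreover have "snd s2 (best_cell n) < W" using s2 W_simps(1) by blast
    ultimately show ?thesis
      using s2 by (intro runs_wp) (cases s2; simp add: best_cell_eval)+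
  qed
  show ?thesis
    unfolding minimum_def by (rule runs_Seq[OF 1 runs_Seq[OF 2 3 order_refl]]) simp_all
qed

section \<open>Correctness and running time\<close>

lemma runs_ipco_program:
  "runs W ipco_program (graph_input n es)
    ((n * (n * (140 * m + 60) + 100) + 6) +
     (n * (1600 * (n * m) + 69 * (n * n) + 45 * n + 40) + 21 * n + 12) + (60 * n + 40))
    (\<lambda>s'. fst s' ''out'' = ipco (with_proj G))"
proof -
  have R: "sized (fst (graph_input n es))" using length_es by (simp add: graph_input_def)
  have M: "holds_edges (snd (graph_input n es))"
    using length_es by (simp add: graph_input_def holds_edges_def)
  have 1: "runs W distances (fst (graph_input n es), snd (graph_input n es))
     (n * (n * (140 * m + 60) + 100) + 6) (\<lambda>s'. sized (fst s') \<and> rows n (snd s'))"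
    using R by (intro runs_distances[OF R M]) simp_all
  have 2: "runs W cover_numbers s1 (n * (1600 * (n * m) + 69 * (n * n) + 45 * n + 40) + 21 * n + 12)
     (\<lambda>s'. sized (fst s') \<and> best n (snd s'))"
    if "sized (fst s1) \<and> rows n (snd s1)" for s1
    using runs_cover_numbers[of "fst s1" "snd s1"] that by simp
  have 3: "runs W minimum s2 (60 * n + 40) (\<lambda>s'. fst s' ''out'' = ipco (with_proj G))"
    if s2: "sized (fst s2) \<and> best n (snd s2)" for s2
  proof -
    have ex: "\<exists>p. geodesic p \<and> snd (greedy (dist v) p) = snd s2 (best_cell v)" if "v < n" for v
      using s2 that by (simp add: best_def)
    have all: "snd (greedy (dist v) p) \<le> snd s2 (best_cell v)" if "v < n" "geodesic p" for v p
      using s2 that walk_ends[OF geodesic_walk[OF that(2)]] by (simp add: best_def)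
    have le: "snd s2 (best_cell v) \<le> n" if "v < n" for v
      using ex[OF that] greedy_le_n that by metis
    have "runs W minimum (fst s2, snd s2) (60 * n + 40) (\<lambda>s'. fst s' ''out'' = ipco (with_proj G))"
    proof (rule runs_mono[OF runs_minimum])
      fix s' :: state
      assume min: "(\<forall>v<n. fst s' ''out'' \<le> snd s2 (best_cell v)) \<and> (\<exists>v<n. snd s2 (best_cell v) = fst s' ''out'')"
      then obtain w where w: "w < n" "snd s2 (best_cell w) = fst s' ''out''" by blast
      have "ipco (with_proj G) = fst s' ''out''"
      proof (rule ipco_eqI)
        show "w \<in> pverts G" using w by simp
        show "snd (greedy (dist w) p) \<le> fst s' ''out''" if "geodesic p" for p
          using all[OF w(1) that] w(2) by simp
        show "\<exists>p. geodesic p \<and> fst s' ''out'' \<le> snd (greedy (dist v) p)" if "v \<in> pverts G" for v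
          using min ex[of v] that by (metis in_verts)
      qed
      then show "fst s' ''out'' = ipco (with_proj G)" by simp
    qed (use s2 le in auto)
    then show ?thesis by simp
  qed
  show ?thesis
    unfolding ipco_program_def
    by (rule runs_Seq[OF 1[unfolded prod.collapse] runs_Seq[OF 2 3 order_refl]]) simp_all
qed

lemma time_bound:
  assumes "2 \<le> n"
  shows "(n * (n * (140 * m + 60) + 100) + 6) +
     (n * (1600 * (n * m) + 69 * (n * n) + 45 * n + 40) + 21 * n + 12) + (60 * n + 40)
     \<le> 5000 * (n\<^sup>2 * m)"
proof -
  have m: "1 \<le> m" "n \<le> 2 * m" using n_le assms by auto
  define z where "z = n\<^sup>2 * m"
  have "n * n * n \<le> n * n * (2 * m)" using m by (intro mult_left_mono) auto
  then have nnn: "n * n * n \<le> 2 * z" by (simp only: z_def power2_eq_square ac_simps)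
  have "n * n * 1 \<le> n * n * m" using m by (intro mult_left_mono) auto
  then have nn: "n * n \<le> z" by (simp only: z_def power2_eq_square mult_1_right)
  have n: "n * 1 \<le> n * n" "1 \<le> n" using assms by (intro mult_left_mono, auto)
  have "(n * (n * (140 * m + 60) + 100) + 6) +
     (n * (1600 * (n * m) + 69 * (n * n) + 45 * n + 40) + 21 * n + 12) + (60 * n + 40)
    = 1740 * z + 69 * (n * n * n) + 105 * (n * n) + 221 * n + 58"
    by (simp add: z_def power2_eq_square algebra_simps)
  also have "\<dots> \<le> 5000 * z" using nnn nn n by linarith
  finally show ?thesis unfolding z_def .
qed

end

theorem theorem2:
  shows "\<exists>P c d. computes_within P (\<lambda>G. ipco (with_proj G)) (\<lambda>n m. c * (n\<^sup>2 * m)) d"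
proof -
  have "computes_within ipco_program (\<lambda>G. ipco (with_proj G)) (\<lambda>n m. 5000 * (n\<^sup>2 * m)) 12"
    unfolding computes_within_def
  proof (intro allI impI)
    fix G :: "nat pair_pre_digraph" and n m es
    assume asm: "pair_graph G \<and> connected (with_proj G) \<and> pverts G = {0..<n} \<and>
        card (uedges G) = m \<and> edge_list_of G es"
    then interpret edge_list_input G n m es
      by (simp add: edge_list_input_def edge_list_input_axioms_def connected_graph_def
        connected_graph_axioms_def)
    show "\<exists>t s. exec ((n + 2) ^ 12) ipco_program (graph_input n es) t s \<and>
        fst s ''out'' = ipco (with_proj G) \<and> (2 \<le> n \<longrightarrow> t \<le> 5000 * (n\<^sup>2 * m))"
      using runs_ipco_program time_bound unfolding runs_def W_def by (meson le_trans)
  qed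
  then show ?thesis by blast
qed

end
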